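(* Let $Y$ be a dendrite whose endpoint set $E(Y)$ is closed in $Y$. Then every continuous map $f:E(Y)\to E(Y)$ can be extended to a continuous map $F:Y\to Y$ such that each point of $Y\setminus E(Y)$ is eventually fixed for $F$.
   Context: A dendrite is a locally connected continuum (compact connected metric space) containing no subspace homeomorphic to the circle. Its endpoint set is $E(Y)=\{y\in Y : Y\setminus\{y\}\text{ is connected}\}$ (the empty set is considered connected). A point $y\in Y$ is eventually fixed for $F:Y\to Y$ if for some $n\ge 0$ the point $F^n(y)$ is a fixed point, i.e. $F^n(y)=F^{n+1}(y)$. *)

theory Defs
  imports "HOL-Analysis.Analysis"
begin

definition dendrite :: "'a::metric_space set \<Rightarrow> bool" where
  "dendrite Y \<longleftrightarrow>
     compact Y \<and> connected Y \<and> locally connected Y \<and>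
     \<not> (\<exists>C\<subseteq>Y. C homeomorphic sphere (0::complex) 1)"

(* For a one-point space this is the space itself, since the library counts {} as connected. *)
definition endpoints :: "'a::metric_space set \<Rightarrow> 'a set" where
  "endpoints Y = {y \<in> Y. connected (Y - {y})}"

(* Maps are total functions on the ambient type; for F mapping Y into Y and y in Y
   the iterates only involve the values of F on Y. *)
definition eventually_fixed :: "('a \<Rightarrow> 'a) \<Rightarrow> 'a \<Rightarrow> bool" where
  "eventually_fixed F y \<longleftrightarrow> (\<exists>n::nat. (F ^^ n) y = (F ^^ (n + 1)) y)"

end

theory Submission
  imports Defs
begin

text \<open>
  Fix a root \<open>r\<close> outside \<open>E = E(Y)\<close> and write \<open>x \<preceq> y\<close> if \<open>x\<close> separates \<open>r\<close> from \<open>y\<close> (or is one of the two).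
  This is a closed tree order, dense because \<open>Y\<close> contains no circle, and \<open>{y. x \<prec> y}\<close> is open for
  every \<open>x\<close>. Since \<open>E\<close> is closed, there is a continuous height \<open>h \<ge> 0\<close> on \<open>Y\<close> that is strictly
  decreasing along the order and vanishes exactly on \<open>E\<close>. Truncating a point \<open>y\<close> at level \<open>c\<close>, that is,
  sliding it down towards \<open>r\<close> until the height is at least \<open>c\<close>, is continuous in \<open>(y, c)\<close>; at a fixed
  positive level it is locally constant on \<open>E\<close>. Let \<open>s y\<close> be a point of \<open>E\<close> closest to \<open>y\<close> and put
  \<open>F y = trunc (f (s y)) (C y)\<close>, where \<open>C y\<close> is continuous, vanishes on \<open>E\<close>, and outside \<open>E\<close> is so large
  that the discontinuous choice of \<open>s y\<close> does not matter. If moreover \<open>C y \<ge> min (h r) (2 * h y)\<close>, the height at least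
  doubles along each orbit until the orbit reaches the fixed point \<open>r\<close>.
\<close>

section \<open>Paths in locally connected compact metric spaces\<close>

text \<open>Being joined by a chain with steps below \<open>d\<close> is an equivalence relation
  with open classes, so a connected set is a single class. A chain is an infinite sequence that is
  eventually \<open>b\<close>, so it can be padded to any larger length.\<close>

lemma connected_imp_chain:
  fixes S :: "'a::metric_space set"
  assumes "connected S" "a \<in> S" "b \<in> S" "0 < d"
  shows "\<exists>u k. u 0 = a \<and> (\<forall>i\<ge>k. u i = b) \<and> (\<forall>i. u i \<in> S) \<and>
      (\<forall>i::nat. dist (u i) (u (Suc i)) < d)"
proof -
  define R :: "'a \<Rightarrow> 'a \<Rightarrow> bool" where "R = (\<lambda>x y. x \<in> S \<and> y \<in> S \<and> dist x y < d)"
  have sym: "symp R"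
    by (auto simp: R_def symp_def dist_commute)
  have "R\<^sup>*\<^sup>* a b"
  proof (rule connected_equivalence_relation[OF assms(1-3)])
    show "R\<^sup>*\<^sup>* y x" if "R\<^sup>*\<^sup>* x y" for x y
      using that sym by (meson symp_rtranclp sympD)
    show "R\<^sup>*\<^sup>* x z" if "R\<^sup>*\<^sup>* x y" "R\<^sup>*\<^sup>* y z" for x y z
      using that by auto
    show "\<exists>T. openin (top_of_set S) T \<and> x \<in> T \<and> (\<forall>y\<in>T. R\<^sup>*\<^sup>* x y)" if "x \<in> S" for x
      using that \<open>0 < d\<close>
      by (intro exI[of _ "S \<inter> ball x d"]) (auto simp: R_def openin_open_Int)
  qed
  then show ?thesis
  proof (induction rule: rtranclp_induct)
    case base
    show ?case
      using assms by (intro exI[of _ "\<lambda>_. a"]) auto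
  next
    case (step y z)
    then obtain u k where u: "u 0 = a" "\<forall>i\<ge>k. u i = y" "\<forall>i. u i \<in> S"
      "\<forall>i::nat. dist (u i) (u (Suc i)) < d"
      by auto
    have "R y z" by fact
    then have "z \<in> S" "dist y z < d"
      by (auto simp: R_def)
    then show ?case
      using u \<open>0 < d\<close>
      by (intro exI[of _ "\<lambda>i. if i \<le> k then u i else z"] exI[of _ "Suc k"]) (auto simp: not_le)
  qed
qed

text \<open>\<open>d\<close> is a Lebesgue number of a cover by open sets with connected trace
  inside a ball of radius \<open>e/2\<close>. A trace containing \<open>a\<close> then stays within
  \<open>e\<close> of \<open>a\<close>.\<close>

lemma uniformly_locally_connected:
  fixes Y :: "'a::metric_space set"
  assumes "compact Y" "locally connected Y" "0 < e"
  shows "\<exists>d>0. \<forall>a\<in>Y. \<forall>b\<in>Y. dist a b < d \<longrightarrow>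
    (\<exists>C. connected C \<and> C \<subseteq> Y \<inter> ball a e \<and> a \<in> C \<and> b \<in> C)"
proof -
  have "\<exists>U. open U \<and> connected (Y \<inter> U) \<and> x \<in> U \<and> Y \<inter> U \<subseteq> ball x (e/2)" if "x \<in> Y" for x
  proof -
    have "openin (top_of_set Y) (Y \<inter> ball x (e/2)) \<and> x \<in> Y \<inter> ball x (e/2)"
      using that \<open>0 < e\<close> by (auto simp: openin_open_Int)
    then obtain u where "openin (top_of_set Y) u" "connected u" "x \<in> u" "u \<subseteq> Y \<inter> ball x (e/2)"
      using \<open>locally connected Y\<close> unfolding locally_connected by blast
    then show ?thesis
      unfolding openin_open by blast
  qed
  then have "\<exists>U. \<forall>x\<in>Y. open (U x) \<and> connected (Y \<inter> U x) \<and> x \<in> U x \<and> Y \<inter> U x \<subseteq> ball x (e/2)"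
    by (intro bchoice ballI)
  then obtain U where U: "\<And>x. x \<in> Y \<Longrightarrow> open (U x) \<and> connected (Y \<inter> U x) \<and> x \<in> U x \<and> Y \<inter> U x \<subseteq> ball x (e/2)"
    by blast
  have "Y \<subseteq> \<Union>(U ` Y)" "\<And>G. G \<in> U ` Y \<Longrightarrow> open G"
    using U by auto
  then obtain d where d: "0 < d" "\<And>x. x \<in> Y \<Longrightarrow> \<exists>G\<in>U ` Y. ball x d \<subseteq> G"
    using Heine_Borel_lemma[OF \<open>compact Y\<close>, of "U ` Y"] by blast
  show ?thesis
  proof (intro exI[of _ d] conjI ballI impI)
    fix a b assume ab: "a \<in> Y" "b \<in> Y" "dist a b < d"
    then obtain x where x: "x \<in> Y" "ball a d \<subseteq> U x"
      using d by blast
    have "Y \<inter> U x \<subseteq> ball a e"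
    proof
      fix z assume z: "z \<in> Y \<inter> U x"
      have "a \<in> Y \<inter> U x"
        using x ab d by auto
      then have "dist x a < e/2" "dist x z < e/2"
        using U[OF x(1)] z by auto
      then show "z \<in> ball a e"
        by (metis dist_commute dist_triangle_half_r mem_ball)
    qed
    then show "\<exists>C. connected C \<and> C \<subseteq> Y \<inter> ball a e \<and> a \<in> C \<and> b \<in> C"
      using x ab d U by (intro exI[of _ "Y \<inter> U x"]) auto
  qed (fact d)
qed

lemma geometric_Cauchy_limit:
  fixes s :: "nat \<Rightarrow> 'a::metric_space"
  assumes "complete Y" "\<And>n. s n \<in> Y" "\<And>n. dist (s n) (s (Suc n)) \<le> e / 2 ^ Suc n"
  shows "\<exists>l\<in>Y. \<forall>n. dist (s n) l \<le> e / 2 ^ n"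
proof -
  \<comment> \<open>The right-hand side is the exact partial sum of the geometric series, which
    makes the induction close.\<close>
  have le: "dist (s n) (s (n + m)) \<le> e / 2 ^ n - e / 2 ^ (n + m)" for n m
  proof (induction m)
    case (Suc m)
    have "dist (s n) (s (n + Suc m)) \<le> dist (s n) (s (n + m)) + dist (s (n + m)) (s (Suc (n + m)))"
      by (simp add: dist_triangle)
    also have "\<dots> \<le> e / 2 ^ n - e / 2 ^ (n + m) + e / 2 ^ Suc (n + m)"
      using Suc assms(3)[of "n + m"] by linarith
    also have "\<dots> = e / 2 ^ n - e / 2 ^ (n + Suc m)"
      by (simp add: field_simps)
    finally show ?case .
  qed simp
  have "0 \<le> e"
    using order_trans[OF zero_le_dist assms(3)[of 0]] by simp
  then have le': "dist (s n) (s m) \<le> e / 2 ^ n" if "n \<le> m" for n m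
    using le[of n "m - n"] that
    by (smt (verit) divide_nonneg_nonneg le_add_diff_inverse zero_le_power)
  have lim: "(\<lambda>n. e / 2 ^ n) \<longlonglongrightarrow> 0"
    by (rule LIMSEQ_divide_realpow_zero) simp
  have "Cauchy s"
  proof (rule metric_CauchyI)
    fix r :: real assume "0 < r"
    then obtain N where N: "e / 2 ^ N < r/2"
      using order_tendstoD(2)[OF lim, of "r/2"] by (auto simp: eventually_sequentially)
    show "\<exists>M. \<forall>m\<ge>M. \<forall>n\<ge>M. dist (s m) (s n) < r"
    proof (intro exI allI impI)
      fix m n assume "N \<le> m" "N \<le> n"
      then have "dist (s N) (s m) < r/2" "dist (s N) (s n) < r/2"
        using le' N by (meson le_less_trans)+
      then show "dist (s m) (s n) < r"
        by (rule dist_triangle_half_r)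
    qed
  qed
  then obtain l where l: "l \<in> Y" "s \<longlonglongrightarrow> l"
    using assms(1,2) unfolding complete_def by blast
  have "dist (s n) l \<le> e / 2 ^ n" for n
  proof (rule tendsto_upperbound)
    show "((\<lambda>m. dist (s n) (s m)) \<longlongrightarrow> dist (s n) l) sequentially"
      by (intro tendsto_intros l)
    show "\<forall>\<^sub>F m in sequentially. dist (s n) (s m) \<le> e / 2 ^ n"
      using le' by (auto simp: eventually_sequentially)
  qed auto
  with l show ?thesis
    by blast
qed

text \<open>Every step of \<open>u\<close> is replaced by a finer chain, and all pieces are padded
  to one common length \<open>N\<close>. The new index \<open>i\<close> then lies over the old index
  \<open>i div N\<close>, so refined chains can be compared over one time interval. In the
  application \<open>P i\<close> says that the \<open>i\<close>-th piece stays close to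
  \<open>u i\<close>.\<close>

lemma refine_chain:
  fixes u :: "nat \<Rightarrow> 'a"
  assumes "0 < M" "\<And>i. M \<le> i \<Longrightarrow> u i = b"
    and chain: "\<And>i. \<exists>v k. v 0 = u i \<and> (\<forall>j\<ge>k. v j = u (Suc i)) \<and> (\<forall>j::nat. P i (v j)) \<and> (\<forall>j. R (v j) (v (Suc j)))"
    and end_ok: "\<And>i. P i (u i)" "R b b"
  obtains u' :: "nat \<Rightarrow> 'a" and N where "0 < (N::nat)" "u' 0 = u 0" "\<And>i. M * N \<le> i \<Longrightarrow> u' i = b"
    "\<And>i. P (i div N) (u' i)" "\<And>i. R (u' i) (u' (Suc i))"
proof -
  obtain v k where v: "\<And>i. v i 0 = u i" "\<And>i j. k i \<le> j \<Longrightarrow> v i j = u (Suc i)"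
    "\<And>i j. P i (v i j)" "\<And>i j::nat. R (v i j) (v i (Suc j))"
    using chain by metis
  define N where "N = Suc (Max (k ` {..<M}))"
  \<comment> \<open>Only the finitely many pieces before \<open>M\<close> enter the maximum; later
    pieces are set to the constant \<open>b\<close>, so that \<open>N\<close> suffices for all of
    them.\<close>
  define w where "w = (\<lambda>i. if i < M then v i else (\<lambda>_. b))"
  have "0 < N" by (simp add: N_def)
  have kN: "k i \<le> N" if "i < M" for i
    unfolding N_def using that by (intro le_SucI Max_ge) auto
  have w0: "w i 0 = u i" and wN: "w i N = u (Suc i)" and wP: "P i (w i j)"
    and wR: "R (w i j) (w i (Suc j))" for i j
    using v kN[of i] end_ok(2) end_ok(1)[of i] assms(2)[of i] assms(2)[of "Suc i"] by (auto simp: w_def not_less)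
  show thesis
  proof (rule that[of N "\<lambda>m. w (m div N) (m mod N)"])
    show "w (i div N) (i mod N) = b" if "M * N \<le> i" for i
    proof -
      have "M \<le> i div N"
        using that \<open>0 < N\<close> by (simp add: less_eq_div_iff_mult_less_eq)
      then show ?thesis
        by (simp add: w_def)
    qed
    show "R (w (i div N) (i mod N)) (w (Suc i div N) (Suc i mod N))" for i
    \<comment> \<open>At the end of a piece the index wraps around: \<open>w i N\<close> and
      \<open>w (Suc i) 0\<close> are both \<open>u (Suc i)\<close>.\<close>
    proof (cases "Suc (i mod N) = N")
      case True
      then have "Suc i mod N = 0" "Suc i div N = Suc (i div N)"
        by (simp_all add: mod_Suc div_Suc)
      then show ?thesis
        using wR[of "i div N" "i mod N"] True by (simp add: w0 wN)
    next
      case False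
      then have "Suc i mod N = Suc (i mod N)" "Suc i div N = i div N"
        by (simp_all add: mod_Suc div_Suc)
      then show ?thesis
        using wR by simp
    qed
  qed (use \<open>0 < N\<close> wP w0 in auto)
qed

text \<open>The path is the uniform limit of the step functions given by successively refined chains
  from \<open>a\<close> to \<open>b\<close>.\<close>

theorem locally_connected_short_paths:
  fixes Y :: "'a::metric_space set"
  assumes "compact Y" "locally connected Y" "0 < e"
  shows "\<exists>d>0. \<forall>a\<in>Y. \<forall>b\<in>Y. dist a b < d \<longrightarrow>
    (\<exists>g. path g \<and> path_image g \<subseteq> Y \<inter> cball a e \<and> pathstart g = a \<and> pathfinish g = b)"
proof -
  have "\<forall>n::nat. \<exists>d>0. \<forall>a\<in>Y. \<forall>b\<in>Y. dist a b < d \<longrightarrow>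
      (\<exists>C. connected C \<and> C \<subseteq> Y \<inter> ball a (e / 2 ^ Suc n) \<and> a \<in> C \<and> b \<in> C)"
    using \<open>0 < e\<close> by (intro allI uniformly_locally_connected[OF assms(1,2)]) simp
  then obtain D0 :: "nat \<Rightarrow> real" where "\<forall>n. 0 < D0 n \<and> (\<forall>a\<in>Y. \<forall>b\<in>Y. dist a b < D0 n \<longrightarrow>
      (\<exists>C. connected C \<and> C \<subseteq> Y \<inter> ball a (e / 2 ^ Suc n) \<and> a \<in> C \<and> b \<in> C))"
    by (rule exE[OF choice])
  then have D0: "\<And>n. 0 < D0 n" "\<And>n a b. \<lbrakk>a \<in> Y; b \<in> Y; dist a b < D0 n\<rbrakk> \<Longrightarrow>
      \<exists>C. connected C \<and> C \<subseteq> Y \<inter> ball a (e / 2 ^ Suc n) \<and> a \<in> C \<and> b \<in> C"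
    by (simp_all del: power_Suc)
  \<comment> \<open>The second bound makes the jumps of the step functions tend to zero, which gives
    continuity of the limit.\<close>
  define D where "D = (\<lambda>n. min (D0 n) (e / 2 ^ n))"
  have D: "0 < D n" "D n \<le> e / 2 ^ n" for n
    using D0(1) \<open>0 < e\<close> by (auto simp: D_def)
  show ?thesis
  proof (intro exI[of _ "D 0"] conjI ballI impI)
    fix a b assume ab: "a \<in> Y" "b \<in> Y" "dist a b < D 0"
    define P where "P = (\<lambda>n (M, u). 0 < (M::nat) \<and> u (0::nat) = a \<and> (\<forall>i\<ge>M. u i = b) \<and> (\<forall>i. u i \<in> Y) \<and>
      (\<forall>i. dist (u i) (u (Suc i)) < D n))"
    define Q where "Q = (\<lambda>n (M, u) (M', u'). \<exists>N>0. M' = M * (N::nat) \<and>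
      (\<forall>i::nat. dist (u (i div N)) (u' i :: 'a) < e / 2 ^ Suc n))"
    define s0 where "s0 = (1::nat, \<lambda>i::nat. if i = 0 then a else b)"
    \<comment> \<open>Dependent choice of chains, each refining the previous one. Fixing the first
      chain as the single step from \<open>a\<close> to \<open>b\<close> later keeps the path within
      \<open>e\<close> of \<open>a\<close>.\<close>
    have "\<exists>s. (\<forall>n. (P n (s n) \<and> (n = 0 \<longrightarrow> s n = s0)) \<and> Q n (s n) (s (Suc n)))"
    proof (rule dependent_nat_choice)
      show "\<exists>x. P 0 x \<and> (0 = 0 \<longrightarrow> x = s0)"
        using ab D(1) by (auto simp: P_def s0_def)
    next
      fix x n assume x: "P n x \<and> (n = 0 \<longrightarrow> x = s0)"
      obtain M u where xMu: "x = (M, u)"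
        by force
      have u: "0 < M" "u 0 = a" "\<And>i. i \<ge> M \<Longrightarrow> u i = b" "\<And>i. u i \<in> Y"
        "\<And>i. dist (u i) (u (Suc i)) < D n"
        using x unfolding P_def xMu by auto
      obtain u' N where u': "0 < (N::nat)" "u' 0 = u 0" "\<And>i. M * N \<le> i \<Longrightarrow> u' i = b"
        "\<And>i. u' i \<in> Y \<and> dist (u (i div N)) (u' i) < e / 2 ^ Suc n"
        "\<And>i. dist (u' i) (u' (Suc i)) < D (Suc n)"
      proof (rule refine_chain[OF u(1), of u b "\<lambda>i z. z \<in> Y \<and> dist (u i) z < e / 2 ^ Suc n"
            "\<lambda>y z. dist y z < D (Suc n)"])
        show "dist b b < D (Suc n)" and "u i \<in> Y \<and> dist (u i) (u i) < e / 2 ^ Suc n" for i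
          using D(1) u \<open>0 < e\<close> by auto
        fix i
        obtain C where C: "connected C" "C \<subseteq> Y \<inter> ball (u i) (e / 2 ^ Suc n)" "u i \<in> C" "u (Suc i) \<in> C"
          using D0(2)[of "u i" "u (Suc i)" n] u unfolding D_def by (metis min_less_iff_conj)
        obtain v k where "v 0 = u i" "\<forall>j\<ge>k. v j = u (Suc i)" "\<forall>j. v j \<in> C"
            "\<forall>j::nat. dist (v j) (v (Suc j)) < D (Suc n)"
          using connected_imp_chain[OF C(1,3,4) D(1)[of "Suc n"]] by (elim exE conjE)
        then show "\<exists>v k. v 0 = u i \<and> (\<forall>j\<ge>k. v j = u (Suc i)) \<and>
            (\<forall>j::nat. v j \<in> Y \<and> dist (u i) (v j) < e / 2 ^ Suc n) \<and> (\<forall>j. dist (v j) (v (Suc j)) < D (Suc n))"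
          using C(2) by (intro exI[of _ v] exI[of _ k]) auto
      qed (use u in auto)
      show "\<exists>y. (P (Suc n) y \<and> (Suc n = 0 \<longrightarrow> y = s0)) \<and> Q n x y"
        using u u' by (intro exI[of _ "(M * N, u')"]) (auto simp: P_def Q_def xMu)
    qed
    then obtain s where s: "\<And>n. P n (s n)" "\<And>n. Q n (s n) (s (Suc n))" "s 0 = s0"
      by blast
    define M where "M = (\<lambda>n. fst (s n))"
    define u where "u = (\<lambda>n. snd (s n))"
    have sMu: "s n = (M n, u n)" for n
      by (simp add: M_def u_def)
    have M: "0 < M n" and u0: "u n 0 = a" and ub: "i \<ge> M n \<Longrightarrow> u n i = b" and uY: "u n i \<in> Y"
      and ud: "dist (u n i) (u n (Suc i)) < D n" for n i
      using s(1)[of n] by (auto simp: P_def sMu)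
    have uu: "\<exists>N>0. M (Suc n) = M n * N \<and>
        (\<forall>i. dist (u n (i div N)) (u (Suc n) i) < e / 2 ^ Suc n)" for n
      using s(2)[of n] by (simp add: Q_def sMu)
    have M0: "M 0 = 1" "u 0 = (\<lambda>i. if i = 0 then a else b)"
      using s(3) by (auto simp: s0_def M_def u_def)
    define f where "f = (\<lambda>n (t::real). u n (nat \<lfloor>t * M n\<rfloor>))"
    have "dist (f n t) (f (Suc n) t) \<le> e / 2 ^ Suc n" if "0 \<le> t" for n t
    proof -
      obtain N where N: "0 < N" "M (Suc n) = M n * N"
        "\<And>i. dist (u n (i div N)) (u (Suc n) i) < e / 2 ^ Suc n"
        using uu by blast
      \<comment> \<open>At every time \<open>t\<close> the cell of the fine chain lies over the cell
        of the coarse one, so \<open>Q\<close> compares exactly the two values at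
        \<open>t\<close>.\<close>
      have "\<lfloor>t * M n\<rfloor> = \<lfloor>t * M (Suc n) / of_int (int N)\<rfloor>"
        using N by simp
      also have "\<dots> = \<lfloor>t * M (Suc n)\<rfloor> div int N"
        by (rule floor_divide_real_eq_div) simp
      finally have "nat \<lfloor>t * M n\<rfloor> = nat \<lfloor>t * M (Suc n)\<rfloor> div N"
        using that by (simp add: nat_div_distrib)
      then show ?thesis
        using N(3) unfolding f_def by (metis less_imp_le)
    qed
    then have "\<exists>l\<in>Y. \<forall>n. dist (f n t) l \<le> e / 2 ^ n" if "0 \<le> t" for t
      using that uY by (intro geometric_Cauchy_limit compact_imp_complete[OF \<open>compact Y\<close>]) (auto simp: f_def)
    then have "\<forall>t\<in>{0..}. \<exists>l. l \<in> Y \<and> (\<forall>n. dist (f n t) l \<le> e / 2 ^ n)"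
      by auto
    from bchoice[OF this]
    obtain g where g: "\<And>t. 0 \<le> t \<Longrightarrow> g t \<in> Y" "\<And>t n. 0 \<le> t \<Longrightarrow> dist (f n t) (g t) \<le> e / 2 ^ n"
      by auto
    have lim: "(\<lambda>n. e / 2 ^ n) \<longlonglongrightarrow> 0"
      by (rule LIMSEQ_divide_realpow_zero) simp
    have const: "g t = z" if "0 \<le> t" "\<And>n. f n t = z" for t z
    proof -
      have "dist z (g t) \<le> 0"
        by (rule tendsto_lowerbound[OF lim]) (use g(2)[OF that(1)] that(2) in auto)
      then show ?thesis
        by simp
    qed
    have g0: "g 0 = a"
      by (rule const) (simp_all add: f_def u0)
    have g1: "g 1 = b"
      by (rule const) (simp_all add: f_def ub)
    have step: "dist (u n i) (u n j) < D n" if "i \<le> Suc j" "j \<le> Suc i" for n i j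
    proof -
      have "i = j \<or> i = Suc j \<or> j = Suc i"
        using that by linarith
      then show ?thesis
        using ud[of n i] ud[of n j] D(1)[of n] by (auto simp: dist_commute)
    qed
    have "continuous_on {0..1} g"
      unfolding continuous_on_iff
    proof (intro ballI allI impI)
      fix t r :: real assume t: "t \<in> {0..1}" and "0 < r"
      obtain n where n: "e / 2 ^ n < r / 3"
        using order_tendstoD(2)[OF lim, of "r/3"] \<open>0 < r\<close> by (auto simp: eventually_sequentially)
      show "\<exists>d>0. \<forall>t'\<in>{0..1}. dist t' t < d \<longrightarrow> dist (g t') (g t) < r"
      \<comment> \<open>Times closer than one cell width fall into equal or adjacent cells, where
        the step function changes by less than \<open>D n\<close>.\<close>
      proof (intro exI[of _ "1 / M n"] conjI ballI impI)
        fix t' :: real assume t': "t' \<in> {0..1}" "dist t' t < 1 / M n"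
        have "\<bar>t' * M n - t * M n\<bar> < 1"
          using t'(2) M[of n] by (simp add: dist_real_def pos_less_divide_eq abs_mult flip: left_diff_distrib)
        then have "\<lfloor>t' * M n\<rfloor> \<le> \<lfloor>t * M n\<rfloor> + 1" "\<lfloor>t * M n\<rfloor> \<le> \<lfloor>t' * M n\<rfloor> + 1"
          by linarith+
        then have "dist (f n t') (f n t) < D n"
          unfolding f_def by (intro step) linarith+
        then have "dist (f n t') (f n t) < r / 3"
          using D(2)[of n] n by linarith
        moreover have "dist (f n t') (g t') < r / 3" "dist (f n t) (g t) < r / 3"
          using t t' le_less_trans[OF g(2) n] by simp_all
        moreover have "dist (g t') (g t) \<le> dist (f n t') (g t') + dist (f n t') (f n t) + dist (f n t) (g t)"
          using dist_triangle[of "g t'" "g t" "f n t'"] dist_triangle[of "f n t'" "g t" "f n t"]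
          by (simp add: dist_commute)
        ultimately show "dist (g t') (g t) < r"
          by linarith
      qed (use M in simp)
    qed
    moreover have "g t \<in> Y \<inter> cball a e" if "t \<in> {0..1}" for t
    \<comment> \<open>The first step function is \<open>a\<close> on all of [0,1) and jumps to
      \<open>b\<close> at 1. Before 1 the limit is therefore within \<open>e\<close> of
      \<open>a\<close>; at 1 the bound on \<open>dist a b\<close> serves instead.\<close>
    proof (cases "t = 1")
      case True
      have "dist a b \<le> e"
        using ab(3) D(2)[of 0] by simp
      then show ?thesis
        using True g1 ab by simp
    next
      case False
      then have "nat \<lfloor>t * M 0\<rfloor> = 0"
        using that M0 by (simp add: nat_eq_iff2 floor_eq_iff)
      then have "f 0 t = a"
        by (simp add: f_def u0)
      then show ?thesis
        using g[of t] g(2)[of t 0] that by simp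
    qed
    ultimately show "\<exists>g. path g \<and> path_image g \<subseteq> Y \<inter> cball a e \<and> pathstart g = a \<and> pathfinish g = b"
      using g0 g1 by (intro exI[of _ g]) (auto simp: path_def path_image_def pathstart_def pathfinish_def)
  qed (fact D(1))
qed

section \<open>Path and arc connectedness\<close>

text \<open>Short paths between nearby points stay inside the open set, so its path components are
  open, and a connected set has only one.\<close>

lemma connected_open_imp_path_connected:
  fixes Y :: "'a::metric_space set"
  assumes "compact Y" "locally connected Y" "openin (top_of_set Y) U" "connected U"
  shows "path_connected U"
  unfolding path_connected_component
proof (intro ballI)
  fix x y assume xy: "x \<in> U" "y \<in> U"
  show "path_component U x y"
  proof (rule connected_equivalence_relation[OF \<open>connected U\<close> xy])
    fix a assume "a \<in> U"
    obtain e where e: "0 < e" "\<And>z. z \<in> Y \<Longrightarrow> dist z a < e \<Longrightarrow> z \<in> U"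
      using \<open>a \<in> U\<close> assms(3) unfolding openin_euclidean_subtopology_iff by blast
    have "U \<subseteq> Y"
      using assms(3) openin_imp_subset by blast
    have "0 < e / 2"
      using e by simp
    from locally_connected_short_paths[OF assms(1,2) this]
    obtain d where d: "0 < d" "\<forall>a\<in>Y. \<forall>b\<in>Y. dist a b < d \<longrightarrow>
        (\<exists>g. path g \<and> path_image g \<subseteq> Y \<inter> cball a (e/2) \<and> pathstart g = a \<and> pathfinish g = b)"
      by (elim exE conjE)
    have "path_component U a z" if z: "z \<in> U \<inter> ball a d" for z
    proof -
      obtain g where g: "path g" "path_image g \<subseteq> Y \<inter> cball a (e/2)" "pathstart g = a" "pathfinish g = z"
        using d(2) z \<open>a \<in> U\<close> \<open>U \<subseteq> Y\<close> by (metis Int_iff mem_ball subsetD)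
      moreover have "Y \<inter> cball a (e/2) \<subseteq> U"
        using e by (auto simp: dist_commute)
      ultimately show ?thesis
        unfolding path_component_def by blast
    qed
    then show "\<exists>T. openin (top_of_set U) T \<and> a \<in> T \<and> (\<forall>x\<in>T. path_component U a x)"
      using \<open>a \<in> U\<close> d(1) by (intro exI[of _ "U \<inter> ball a d"]) (auto simp: openin_open_Int)
  qed (blast intro: path_component_sym path_component_trans)+
qed

text \<open>The Kuratowski embedding reduces the statement to \<open>path_contains_arc\<close>, which
  the library proves in Banach spaces.\<close>

lemma path_contains_arc_metric:
  fixes p :: "real \<Rightarrow> 'a::metric_space"
  assumes "path p" "pathstart p = a" "pathfinish p = b" "a \<noteq> b"
  obtains q where "arc q" "path_image q \<subseteq> path_image p" "pathstart q = a" "pathfinish q = b"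
proof -
  \<comment> \<open>Subtracting the distance to the base point \<open>a\<close> makes the distance
    functions bounded without changing their differences.\<close>
  define k where "k = (\<lambda>x. Bcontfun (\<lambda>z::'a. dist z x - dist z a))"
  have "(\<lambda>z. dist z x - dist z a) \<in> bcontfun" for x :: 'a
  proof (rule bcontfun_normI)
    show "norm (dist z x - dist z a) \<le> dist x a" for z
      using abs_dist_diff_le[of x z a] by (simp add: dist_commute)
  qed (intro continuous_intros)
  then have k: "apply_bcontfun (k x) z = dist z x - dist z a" for x z
    by (simp add: k_def Bcontfun_inverse)
  have "dist (k x) (k y) \<le> dist x y" for x y
  proof (rule dist_bound)
    show "dist (apply_bcontfun (k x) z) (apply_bcontfun (k y) z) \<le> dist x y" for z
      using abs_dist_diff_le[of x z y] by (simp add: k dist_real_def dist_commute)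
  qed
  then have contk: "continuous_on S k" for S
    by (intro continuous_on_iff[THEN iffD2]) (meson le_less_trans)
  have injk: "inj_on k S" for S
  proof
    fix x y assume "k x = k y"
    then have "apply_bcontfun (k x) x = apply_bcontfun (k y) x"
      by simp
    then show "x = y"
      by (simp add: k)
  qed
  have "path (k \<circ> p)"
    using contk \<open>path p\<close> path_continuous_image by blast
  moreover have "pathstart (k \<circ> p) = k a" "pathfinish (k \<circ> p) = k b"
    using assms by (simp_all add: pathstart_compose pathfinish_compose)
  moreover have "k a \<noteq> k b"
    using inj_onD[OF injk[of UNIV], of a b] assms(4) by blast
  ultimately obtain q where q: "arc q" "path_image q \<subseteq> path_image (k \<circ> p)" "pathstart q = k a" "pathfinish q = k b"
    by (rule path_contains_arc)
  define j where "j = the_inv_into (path_image p) k"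
  have j: "j (k x) = x" if "x \<in> path_image p" for x
    using that injk by (simp add: j_def the_inv_into_f_f)
  have contj: "continuous_on (k ` path_image p) j"
    using contk j compact_path_image[OF \<open>path p\<close>] by (intro continuous_on_inv) auto
  have img: "path_image q \<subseteq> k ` path_image p"
    using q(2) by (simp add: path_image_compose)
  have ends: "a \<in> path_image p" "b \<in> path_image p"
    using assms by auto
  show thesis
  proof (rule that[of "j \<circ> q"])
    have "inj_on j (k ` path_image p)"
      by (rule inj_on_inverseI[of _ k]) (auto simp: j)
    then have "inj_on j (path_image q)"
      using img inj_on_subset by blast
    moreover have "continuous_on (path_image q) j"
      using contj img continuous_on_subset by blast
    ultimately show "arc (j \<circ> q)"
      using q(1) unfolding arc_def path_image_def by (simp add: comp_inj_on path_continuous_image path_image_def)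
    show "path_image (j \<circ> q) \<subseteq> path_image p"
      using img j by (force simp: path_image_compose)
  qed (use q ends in \<open>auto simp: pathstart_compose pathfinish_compose j\<close>)
qed

text \<open>Both orders of \<open>u\<close> and \<open>v\<close> are allowed: \<open>v < u\<close>
  gives the subarc traversed backwards, as needed to close up a circle from two arcs.\<close>

lemma arc_reparametrize:
  fixes g :: "real \<Rightarrow> 'a::metric_space"
  assumes "arc g" "u \<in> {0..1}" "v \<in> {0..1}" "u \<noteq> v"
  shows "arc (\<lambda>x. g ((v - u) * x + u))" "path_image (\<lambda>x. g ((v - u) * x + u)) = g ` closed_segment u v"
proof -
  have seg: "(\<lambda>x. (v - u) * x + u) ` {0..1} = closed_segment u v"
    by (simp add: closed_segment_real_eq)
  have sub: "closed_segment u v \<subseteq> {0..1}"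
    using assms by (auto simp: closed_segment_eq_real_ivl)
  have "continuous_on {0..1} (g \<circ> (\<lambda>x. (v - u) * x + u))"
    using assms(1) seg sub by (intro continuous_on_compose continuous_intros) (auto simp: arc_def path_def intro: continuous_on_subset)
  moreover have "inj_on (\<lambda>x. (v - u) * x + u) {0..1}"
    using assms(4) by (auto simp: inj_on_def)
  then have "inj_on (g \<circ> (\<lambda>x. (v - u) * x + u)) {0..1}"
    using assms(1) seg sub by (intro comp_inj_on) (auto simp: arc_def intro: inj_on_subset)
  ultimately show "arc (\<lambda>x. g ((v - u) * x + u))"
    by (simp add: arc_def path_def comp_def)
  show "path_image (\<lambda>x. g ((v - u) * x + u)) = g ` closed_segment u v"
    by (simp add: path_image_def image_image flip: seg)
qed

section \<open>The cut point order of a rooted dendrite\<close>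

text \<open>An inner point \<open>p\<close> of an arc \<open>A\<close> from \<open>a\<close> to
  \<open>b\<close> separates them. Otherwise a second arc \<open>B\<close> from \<open>a\<close> to
  \<open>b\<close> avoids \<open>p\<close>, and a piece of \<open>B\<close> bypassing
  \<open>p\<close> forms a circle with a subarc of \<open>A\<close>.\<close>

lemma dendrite_separating_point:
  fixes Y :: "'a::metric_space set"
  assumes "dendrite Y" "a \<in> Y" "b \<in> Y" "a \<noteq> b"
  obtains p where "p \<in> Y" "p \<noteq> a" "p \<noteq> b" "\<not> connected_component (Y - {p}) a b"
proof -
  have Y: "compact Y" "connected Y" "locally connected Y"
    and nocircle: "\<And>C. C \<subseteq> Y \<Longrightarrow> \<not> C homeomorphic sphere (0::complex) 1"
    using assms(1) unfolding dendrite_def by auto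
  have "path_connected Y"
    using connected_open_imp_path_connected[of Y Y] Y by simp
  then obtain g where "path g" "path_image g \<subseteq> Y" "pathstart g = a" "pathfinish g = b"
    using assms unfolding path_connected_def by blast
  then obtain A where A: "arc A" "path_image A \<subseteq> Y" "pathstart A = a" "pathfinish A = b"
    using path_contains_arc_metric[of g a b] assms(4) by (metis order_trans)
  have A01: "A 0 = a" "A 1 = b" and contA: "continuous_on {0..1} A" and injA: "inj_on A {0..1}"
    using A by (auto simp: pathstart_def pathfinish_def arc_def path_def)
  define p where "p = A (1/2)"
  have half: "A s = p \<longleftrightarrow> s = 1/2" if "s \<in> {0..1}" for s
    unfolding p_def using inj_on_eq_iff[OF injA that, of "1/2"] by simp
  have p: "p \<in> Y" "p \<noteq> a" "p \<noteq> b"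
    using A(2) half[of 0] half[of 1] A01 by (auto simp: p_def path_image_def)
  have False if "connected_component (Y - {p}) a b"
  proof -
    \<comment> \<open>The component is open by local connectedness, hence path connected, and so
      contains an arc from \<open>a\<close> to \<open>b\<close> that misses
      \<open>p\<close>.\<close>
    define U where "U = connected_component_set (Y - {p}) a"
    have opn: "openin (top_of_set Y) (Y - {p})"
      by (simp add: openin_diff p)
    have "openin (top_of_set (Y - {p})) U"
      unfolding U_def using Y opn
      by (intro openin_connected_component_locally_connected locally_open_subset[OF Y(3) opn])
    then have "openin (top_of_set Y) U"
      using opn openin_trans by blast
    moreover have "connected U"
      by (simp add: U_def)
    ultimately have "path_connected U"
      using connected_open_imp_path_connected Y by blast
    moreover have "a \<in> U" "b \<in> U"
      using that p assms by (auto simp: U_def connected_component_refl_eq)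
    ultimately obtain g where "path g" "path_image g \<subseteq> U" "pathstart g = a" "pathfinish g = b"
      unfolding path_connected_def by blast
    then obtain B where B: "arc B" "path_image B \<subseteq> U" "pathstart B = a" "pathfinish B = b"
      using path_contains_arc_metric[of g a b] assms(4) by (metis order_trans)
    have B01: "B 0 = a" "B 1 = b" and contB: "continuous_on {0..1} B" and injB: "inj_on B {0..1}"
      using B by (auto simp: pathstart_def pathfinish_def arc_def path_def)
    have "U \<subseteq> Y - {p}"
      by (simp add: U_def connected_component_subset)
    then have Bp: "B t \<noteq> p" and BY: "B t \<in> Y" if "t \<in> {0..1}" for t
      using B(2) that by (fastforce simp: path_image_def)+
    have closed_piece: "closed (A ` {s..s'})" if "{s..s'} \<subseteq> {0..1}" for s s'
      using that contA by (intro compact_imp_closed compact_continuous_image) (auto intro: continuous_on_subset)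
    \<comment> \<open>\<open>t2\<close> will be the first time at which \<open>B\<close> meets the
      second half of \<open>A\<close>, and \<open>t1\<close> the last time up to \<open>t2\<close>
      at which it meets the first half.\<close>
    define K2 where "K2 = {0..1} \<inter> B -` (A ` {1/2..1})"
    have "compact K2"
      unfolding K2_def
      by (rule closedin_compact[OF compact_Icc continuous_closedin_preimage[OF contB closed_piece]]) simp
    moreover have "1 \<in> K2"
      using A01 B01 by (auto simp: K2_def)
    ultimately obtain t2 where t2: "t2 \<in> K2" "\<And>t. t \<in> K2 \<Longrightarrow> t2 \<le> t"
      using compact_attains_inf[of K2] by blast
    then have t2': "t2 \<in> {0..1}"
      by (simp add: K2_def)
    define K1 where "K1 = {0..t2} \<inter> B -` (A ` {0..1/2})"
    have "continuous_on {0..t2} B"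
      using t2' by (intro continuous_on_subset[OF contB]) auto
    then have "compact K1"
      unfolding K1_def
      by (rule closedin_compact[OF compact_Icc continuous_closedin_preimage[OF _ closed_piece]]) simp
    moreover have "0 \<in> K1"
      using A01 B01 t2' by (auto simp: K1_def image_iff intro!: bexI[of _ 0])
    ultimately obtain t1 where t1: "t1 \<in> K1" "\<And>t. t \<in> K1 \<Longrightarrow> t \<le> t1"
      using compact_attains_sup[of K1] by blast
    then have t1': "t1 \<in> {0..1}" "t1 \<le> t2"
      using t2' by (auto simp: K1_def)
    obtain s1 where s1: "s1 \<in> {0..1/2}" "B t1 = A s1"
      using t1 by (auto simp: K1_def)
    obtain s2 where s2: "s2 \<in> {1/2..1}" "B t2 = A s2"
      using t2 by (auto simp: K2_def)
    \<comment> \<open>The inequalities at 1/2 are strict because \<open>B\<close> never passes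
      through \<open>p\<close>.\<close>
    have s: "s1 \<in> {0..1}" "s2 \<in> {0..1}" "s1 < 1/2" "1/2 < s2"
      using s1 s2 Bp[OF t1'(1)] Bp[OF t2'] half[of s1] half[of s2] by (auto simp: less_le)
    then have "A s1 \<noteq> A s2"
      using inj_on_eq_iff[OF injA, of s1 s2] by simp
    then have "t1 < t2"
      using t1' s1 s2 by (cases "t1 = t2") auto
    have only: "t = t1 \<or> t = t2" if t: "t \<in> {t1..t2}" and "B t \<in> A ` {0..1}" for t
    proof -
      have "t \<in> {0..1}" "t \<in> {0..t2}"
        using t t1' t2' by auto
      have "{0..1} = {0..1/2} \<union> {1/2..1::real}"
        by auto
      then consider "B t \<in> A ` {0..1/2}" | "B t \<in> A ` {1/2..1}"
        using \<open>B t \<in> A ` {0..1}\<close> by (metis UnE image_Un)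
      then show ?thesis
      proof cases
        case 1
        then have "t \<in> K1"
          using \<open>t \<in> {0..t2}\<close> by (simp add: K1_def)
        then show ?thesis
          using t1(2)[of t] t by auto
      next
        case 2
        then have "t \<in> K2"
          using \<open>t \<in> {0..1}\<close> by (simp add: K2_def)
        then show ?thesis
          using t2(2)[of t] t by auto
      qed
    qed
    \<comment> \<open>\<open>g1\<close> follows \<open>A\<close> from \<open>s1\<close> to
      \<open>s2\<close>, and \<open>g2\<close> returns along \<open>B\<close> from \<open>t2\<close>
      to \<open>t1\<close>; by \<open>only\<close> they meet just at their ends.\<close>
    define g1 where "g1 = (\<lambda>x. A ((s2 - s1) * x + s1))"
    define g2 where "g2 = (\<lambda>x. B ((t1 - t2) * x + t2))"
    have arcs: "arc g1" "arc g2"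
      unfolding g1_def g2_def using s t1' t2' \<open>t1 < t2\<close> A(1) B(1) by (auto intro!: arc_reparametrize)
    have img1: "path_image g1 = A ` {s1..s2}" 
      using s arc_reparametrize(2)[OF A(1), of s1 s2] by (simp add: g1_def closed_segment_eq_real_ivl)
    have img2: "path_image g2 = B ` {t1..t2}"
      using t1' t2' \<open>t1 < t2\<close> arc_reparametrize(2)[OF B(1), of t2 t1]
      by (simp add: g2_def closed_segment_eq_real_ivl)
    have ends: "pathstart g1 = A s1" "pathfinish g1 = A s2" "pathstart g2 = A s2" "pathfinish g2 = A s1"
      using s1 s2 by (auto simp: g1_def g2_def pathstart_def pathfinish_def)
    have "path_image g1 \<inter> path_image g2 \<subseteq> {pathstart g1, pathstart g2}"
    proof
      fix z assume z: "z \<in> path_image g1 \<inter> path_image g2"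
      then obtain t where t: "t \<in> {t1..t2}" "z = B t"
        by (auto simp: img2)
      have "z \<in> A ` {0..1}"
        using z s by (auto simp: img1)
      then have "t = t1 \<or> t = t2"
        using only[OF t(1)] t(2) by simp
      then show "z \<in> {pathstart g1, pathstart g2}"
        using t s1 s2 by (auto simp: ends)
    qed
    then have "simple_path (g1 +++ g2)"
      using arcs by (intro simple_path_join_loop) (auto simp: ends)
    then have "path_image (g1 +++ g2) homeomorphic sphere (0::complex) 1"
      by (intro homeomorphic_simple_path_image_circle) (auto simp: ends)
    moreover have "path_image (g1 +++ g2) \<subseteq> Y"
    proof -
      have "path_image g1 \<subseteq> Y"
        unfolding img1 using A(2) s by (force simp: path_image_def)
      moreover have "path_image g2 \<subseteq> Y"
        unfolding img2 using BY t1' t2' by auto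
      ultimately show ?thesis
        by (simp add: subset_path_image_join)
    qed
    ultimately show False
      using nocircle by blast
  qed
  with p that show thesis
    by blast
qed

section \<open>Algebraic properties of the order\<close>

locale rooted_dendrite =
  fixes Y :: "'a::metric_space set" and r :: 'a
  assumes dendrite: "dendrite Y" and root: "r \<in> Y"
begin

text \<open>No separate clauses for \<open>x = r\<close> and \<open>x = y\<close> are needed: \<open>connected_component (Y - {x})\<close> is false
  whenever one of its arguments is \<open>x\<close>.\<close>

definition below :: "'a \<Rightarrow> 'a \<Rightarrow> bool"  (infix "\<preceq>" 50) where
  "x \<preceq> y \<longleftrightarrow> x \<in> Y \<and> y \<in> Y \<and> \<not> connected_component (Y - {x}) r y"

lemma Y: "compact Y" "connected Y" "locally connected Y"
  using dendrite unfolding dendrite_def by auto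

lemma below_in: "x \<preceq> y \<Longrightarrow> x \<in> Y" "x \<preceq> y \<Longrightarrow> y \<in> Y"
  by (auto simp: below_def)

lemma root_below: "y \<in> Y \<Longrightarrow> r \<preceq> y"
  using root connected_component_in[of "Y - {r}" r y] by (auto simp: below_def)

lemma below_refl: "y \<in> Y \<Longrightarrow> y \<preceq> y"
  using connected_component_in[of "Y - {y}" r y] by (auto simp: below_def)

lemma below_connectedD:
  assumes "x \<preceq> y" "connected T" "T \<subseteq> Y" "r \<in> T" "y \<in> T"
  shows "x \<in> T"
  using assms unfolding below_def connected_component_def by blast

lemma not_belowE:
  assumes "\<not> x \<preceq> y" "x \<in> Y" "y \<in> Y"
  obtains T where "connected T" "T \<subseteq> Y" "r \<in> T" "y \<in> T" "x \<notin> T"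
  using assms unfolding below_def connected_component_def by blast

lemma below_trans: "x \<preceq> y \<Longrightarrow> y \<preceq> z \<Longrightarrow> x \<preceq> z"
  by (metis below_connectedD below_in not_belowE)

lemma openin_component_minus:
  "openin (top_of_set Y) (Y - {x})" "openin (top_of_set Y) (connected_component_set (Y - {x}) z)"
proof -
  show opn: "openin (top_of_set Y) (Y - {x})"
    by (simp add: openin_delete)
  show "openin (top_of_set Y) (connected_component_set (Y - {x}) z)"
    by (rule openin_trans[OF openin_connected_component_locally_connected[OF locally_open_subset[OF Y(3) opn]] opn])
qed

text \<open>Boundary bumping: the component accumulates at \<open>x\<close>, as it would otherwise be clopen in \<open>Y\<close>.\<close>

lemma connected_insert_component:
  assumes "x \<in> Y" "z \<in> Y" "z \<noteq> x"
  shows "connected (insert x (connected_component_set (Y - {x}) z))"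
proof -
  define C where "C = connected_component_set (Y - {x}) z"
  have "C \<subseteq> Y - {x}"
    by (simp add: C_def connected_component_subset)
  have "z \<in> C"
    using assms by (simp add: C_def connected_component_refl_eq)
  have "x \<in> closure C"
  proof (rule ccontr)
    assume "x \<notin> closure C"
    have "closedin (top_of_set (Y - {x})) C"
      by (simp add: C_def closedin_connected_component)
    then obtain K where "closed K" "C = (Y - {x}) \<inter> K"
      by (auto simp: closedin_closed)
    moreover from this have "closure C \<subseteq> K"
      by (intro closure_minimal) auto
    ultimately have "closure C \<inter> (Y - {x}) \<subseteq> C"
      by blast
    then have "C = Y \<inter> closure C"
      using \<open>x \<notin> closure C\<close> \<open>C \<subseteq> Y - {x}\<close> closure_subset[of C] by blast
    then have "closedin (top_of_set Y) C"
      by (metis closed_closure closedin_closed_Int)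
    moreover have "openin (top_of_set Y) C"
      by (simp add: C_def openin_component_minus)
    ultimately show False
      using Y(2) \<open>z \<in> C\<close> \<open>C \<subseteq> Y - {x}\<close> assms(1) unfolding connected_clopen by blast
  qed
  then have "insert x C \<subseteq> closure C"
    using closure_subset[of C] by simp
  moreover have "connected C" "C \<subseteq> insert x C"
    by (auto simp: C_def)
  ultimately have "connected (insert x C)"
    by (rule connected_intermediate_closure[rotated 2])
  then show ?thesis
    by (simp add: C_def)
qed

lemma above_component:
  assumes "x \<preceq> y" "x \<noteq> y" "z \<in> connected_component_set (Y - {x}) y"
  shows "x \<preceq> z"
proof -
  have "z \<in> Y - {x}"
    using assms(3) connected_component_subset by blast
  moreover have "\<not> connected_component (Y - {x}) r z"
    using assms connected_component_trans connected_component_sym unfolding below_def by (metis mem_Collect_eq)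
  ultimately show ?thesis
    using assms(1) by (simp add: below_def)
qed

text \<open>The component of \<open>r\<close> in \<open>Y - {x}\<close> together with
  \<open>x\<close> is connected and joins \<open>r\<close> to \<open>x\<close>. It must contain
  \<open>y\<close>, so \<open>x\<close> does not separate \<open>r\<close> from
  \<open>y\<close>.\<close>

lemma below_antisym:
  assumes "x \<preceq> y" "y \<preceq> x"
  shows "x = y"
proof (rule ccontr)
  assume "x \<noteq> y"
  have "x \<noteq> r"
    using below_connectedD[OF \<open>y \<preceq> x\<close>, of "{r}"] \<open>x \<noteq> y\<close> root by auto
  define C where "C = connected_component_set (Y - {x}) r"
  have "y \<in> insert x C"
  proof (rule below_connectedD[OF \<open>y \<preceq> x\<close>])
    show "connected (insert x C)"
      unfolding C_def using assms root \<open>x \<noteq> r\<close> below_in by (intro connected_insert_component) auto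
    show "insert x C \<subseteq> Y"
      using connected_component_subset[of "Y - {x}" r] assms below_in by (auto simp: C_def)
    show "r \<in> insert x C"
      using root \<open>x \<noteq> r\<close> by (simp add: C_def connected_component_refl_eq)
  qed simp
  then show False
    using assms(1) \<open>x \<noteq> y\<close> by (simp add: below_def C_def)
qed

text \<open>Join \<open>r\<close> to \<open>x\<close> by a connected set missing \<open>x'\<close>,
  and continue from \<open>x\<close> to \<open>y\<close> through the component of \<open>y\<close>
  in \<open>Y - {x}\<close>. As \<open>x'\<close> lies on this union, it lies in that component,
  hence above \<open>x\<close>.\<close>

lemma below_linear:
  assumes "x \<preceq> y" "x' \<preceq> y"
  shows "x \<preceq> x' \<or> x' \<preceq> x"
proof (rule ccontr)
  assume contr: "\<not> (x \<preceq> x' \<or> x' \<preceq> x)"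
  then have "x \<noteq> y"
    using assms by auto
  have xY: "x \<in> Y" "y \<in> Y" "x' \<in> Y"
    using assms below_in by auto
  obtain T where T: "connected T" "T \<subseteq> Y" "r \<in> T" "x \<in> T" "x' \<notin> T"
    using contr not_belowE xY by metis
  define B where "B = connected_component_set (Y - {x}) y"
  have "x' \<in> T \<union> insert x B"
  proof (rule below_connectedD[OF assms(2)])
    have "connected (insert x B)"
      unfolding B_def using xY \<open>x \<noteq> y\<close> by (intro connected_insert_component) auto
    then show "connected (T \<union> insert x B)"
      using T by (intro connected_Un) auto
    show "T \<union> insert x B \<subseteq> Y"
      using connected_component_subset[of "Y - {x}" y] xY T by (auto simp: B_def)
    show "y \<in> T \<union> insert x B"
      using xY \<open>x \<noteq> y\<close> by (simp add: B_def connected_component_refl_eq)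
  qed (use T in auto)
  then have "x' = x \<or> x' \<in> B"
    using T by auto
  then show False
    using contr above_component[OF assms(1) \<open>x \<noteq> y\<close>] below_refl xY by (auto simp: B_def)
qed

text \<open>A point separating \<open>x\<close> from \<open>y\<close> lies between them in the
  order. The absence of circles enters here; it later makes the height take all intermediate values
  along a branch.\<close>

lemma below_dense:
  assumes "x \<preceq> y" "x \<noteq> y"
  obtains p where "x \<preceq> p" "x \<noteq> p" "p \<preceq> y" "p \<noteq> y"
proof -
  have xY: "x \<in> Y" "y \<in> Y"
    using assms below_in by auto
  obtain p where p: "p \<in> Y" "p \<noteq> x" "p \<noteq> y" "\<not> connected_component (Y - {p}) x y"
    using dendrite_separating_point[OF dendrite xY assms(2)] by blast
  have sep: "p \<in> T" if "connected T" "T \<subseteq> Y" "x \<in> T" "y \<in> T" for T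
    using p(4) that unfolding connected_component_def by blast
  have "p \<preceq> y"
  proof (rule ccontr)
    assume "\<not> p \<preceq> y"
    then obtain T where "connected T" "T \<subseteq> Y" "r \<in> T" "y \<in> T" "p \<notin> T"
      using not_belowE p xY by metis
    then show False
      using below_connectedD[OF assms(1)] sep by blast
  qed
  define B where "B = connected_component_set (Y - {x}) y"
  have "p \<in> insert x B"
  proof (rule sep)
    show "connected (insert x B)"
      unfolding B_def using xY assms by (intro connected_insert_component) auto
    show "insert x B \<subseteq> Y"
      using connected_component_subset[of "Y - {x}" y] xY by (auto simp: B_def)
    show "y \<in> insert x B"
      using xY assms by (simp add: B_def connected_component_refl_eq)
  qed simp
  then have "x \<preceq> p"
    using p above_component[OF assms] by (simp add: B_def)
  with p \<open>p \<preceq> y\<close> that show thesis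
    by blast
qed

section \<open>Topology of the order\<close>

text \<open>The set is a union of components of \<open>Y - {x}\<close>, which are open by local
  connectedness.\<close>

lemma openin_strictly_above: "openin (top_of_set Y) {y \<in> Y. x \<preceq> y \<and> x \<noteq> y}"
proof (subst openin_subopen, intro ballI)
  fix y assume y: "y \<in> {y \<in> Y. x \<preceq> y \<and> x \<noteq> y}"
  show "\<exists>T. openin (top_of_set Y) T \<and> y \<in> T \<and> T \<subseteq> {y \<in> Y. x \<preceq> y \<and> x \<noteq> y}"
  proof (intro exI conjI)
    show "y \<in> connected_component_set (Y - {x}) y"
      using y by (auto simp add: connected_component_refl_eq)
    show "connected_component_set (Y - {x}) y \<subseteq> {y \<in> Y. x \<preceq> y \<and> x \<noteq> y}"
      using y above_component[of x y] connected_component_subset[of "Y - {x}" y] by auto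
  qed (rule openin_component_minus)
qed

text \<open>A path from \<open>r\<close> to \<open>y\<close> avoiding \<open>x\<close> keeps a
  positive distance from \<open>x\<close>. Hence it also avoids all points near \<open>x\<close>,
  and the component it spans away from \<open>x\<close> is a neighbourhood of
  \<open>y\<close>.\<close>

lemma not_below_nhds:
  assumes "x \<in> Y" "y \<in> Y" "\<not> x \<preceq> y"
  obtains U V where "openin (top_of_set Y) U" "openin (top_of_set Y) V" "x \<in> U" "y \<in> V"
    "\<And>x' y'. \<lbrakk>x' \<in> U; y' \<in> V\<rbrakk> \<Longrightarrow> \<not> x' \<preceq> y'"
proof -
  define A where "A = connected_component_set (Y - {x}) r"
  have A: "openin (top_of_set Y) A" "connected A" "A \<subseteq> Y - {x}"
    by (simp_all add: A_def openin_component_minus connected_component_subset)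
  have "y \<in> A"
    using assms by (simp add: A_def below_def)
  then have "r \<in> A"
    unfolding A_def by (metis connected_component_eq_empty connected_component_refl_eq empty_iff mem_Collect_eq)
  have "path_connected A"
    using connected_open_imp_path_connected[OF Y(1,3) A(1,2)] .
  then obtain g where g: "path g" "path_image g \<subseteq> A" "pathstart g = r" "pathfinish g = y"
    using \<open>r \<in> A\<close> \<open>y \<in> A\<close> unfolding path_connected_def by blast
  have "open (- path_image g)" "x \<in> - path_image g"
    using g A by (auto simp: compact_imp_closed compact_path_image open_Compl)
  then obtain d where d: "0 < d" "cball x d \<subseteq> - path_image g"
    unfolding open_contains_cball by blast
  \<comment> \<open>A closed ball is removed so that \<open>W\<close>, and with it the component of
    \<open>r\<close>, is open in \<open>Y\<close>.\<close>
  define W where "W = Y - cball x d"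
  have opW: "openin (top_of_set Y) W"
    unfolding openin_open W_def by (intro exI[of _ "- cball x d"]) auto
  define V where "V = connected_component_set W r"
  show thesis
  proof (rule that[of "Y \<inter> ball x d" V])
    show "openin (top_of_set Y) V"
      unfolding V_def
      by (rule openin_trans[OF openin_connected_component_locally_connected[OF locally_open_subset[OF Y(3) opW]] opW])
    have "path_image g \<subseteq> W"
      using g A d by (auto simp: W_def)
    then show "y \<in> V"
      using g unfolding V_def connected_component_def mem_Collect_eq
      by (metis connected_path_image pathfinish_in_path_image pathstart_in_path_image)
    fix x' y' assume "x' \<in> Y \<inter> ball x d" "y' \<in> V"
    then have "W \<subseteq> Y - {x'}"
      by (auto simp: W_def)
    then have "connected_component (Y - {x'}) r y'"
      using \<open>y' \<in> V\<close> connected_component_of_subset unfolding V_def by blast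
    then show "\<not> x' \<preceq> y'"
      by (simp add: below_def)
  qed (use d assms in auto)
qed

lemma closed_below: "closed {(x, y). x \<preceq> y}"
proof -
  have "closedin (top_of_set (Y \<times> Y)) {(x, y). x \<preceq> y}"
    unfolding closedin_def
  proof
    show "openin (top_of_set (Y \<times> Y)) (topspace (top_of_set (Y \<times> Y)) - {(x, y). x \<preceq> y})"
    proof (subst openin_subopen, intro ballI)
      fix w assume "w \<in> topspace (top_of_set (Y \<times> Y)) - {(x, y). x \<preceq> y}"
      then obtain x y where w: "w = (x, y)" "x \<in> Y" "y \<in> Y" "\<not> x \<preceq> y"
        by auto
      obtain U V where UV: "openin (top_of_set Y) U" "openin (top_of_set Y) V" "x \<in> U" "y \<in> V"
        "\<And>x' y'. \<lbrakk>x' \<in> U; y' \<in> V\<rbrakk> \<Longrightarrow> \<not> x' \<preceq> y'"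
        using not_below_nhds[OF w(2-4)] by blast
      moreover have "openin (top_of_set (Y \<times> Y)) (U \<times> V)"
        using UV by (intro openin_Times)
      moreover have "U \<subseteq> Y" "V \<subseteq> Y"
        using UV(1,2) openin_imp_subset by blast+
      ultimately show "\<exists>T. openin (top_of_set (Y \<times> Y)) T \<and> w \<in> T \<and>
          T \<subseteq> topspace (top_of_set (Y \<times> Y)) - {(x, y). x \<preceq> y}"
        using w by (intro exI[of _ "U \<times> V"]) auto
    qed
  qed (auto simp: below_in)
  moreover have "closed (Y \<times> Y)"
    using Y(1) by (simp add: closed_Times compact_imp_closed)
  ultimately show ?thesis
    using closedin_closed_trans by blast
qed

lemma compact_below: "compact {x. x \<preceq> y}"
proof -
  have "{x. x \<preceq> y} = Y \<inter> (\<lambda>x. (x, y)) -` {(x, y). x \<preceq> y}"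
    by (auto simp: below_in)
  also have "compact \<dots>"
    by (intro compact_Int_closed Y(1) closed_vimage closed_below continuous_intros)
  finally show ?thesis .
qed

text \<open>Such an \<open>x\<close> is a cut point unless it is the root, which lies below every
  point without separating anything; the hypothesis on \<open>r\<close> covers that case.\<close>

lemma strictly_below_not_endpoint:
  assumes "x \<preceq> y" "x \<noteq> y" "r \<notin> endpoints Y"
  shows "x \<notin> endpoints Y"
proof
  assume "x \<in> endpoints Y"
  then have "connected (Y - {x})" "x \<noteq> r"
    using assms(3) by (auto simp: endpoints_def)
  then have "x \<in> Y - {x}"
    using below_connectedD[OF assms(1), of "Y - {x}"] assms(2) root below_in(2)[OF assms(1)] by auto
  then show False
    by simp
qed

end

section \<open>A height function\<close>

text \<open>Every limit point of the values lies in the compact set \<open>T\<close> and, by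
  closedness of \<open>G\<close>, on the graph. \<open>G\<close> has to agree with the graph only
  over \<open>S\<close> and \<open>T\<close>.\<close>

lemma continuous_on_compact_closed_graph:
  fixes f :: "'a::metric_space \<Rightarrow> 'b::metric_space"
  assumes "compact T" "\<And>x. x \<in> S \<Longrightarrow> f x \<in> T" "closed G"
    and "\<And>x z. \<lbrakk>x \<in> S; z \<in> T\<rbrakk> \<Longrightarrow> (x, z) \<in> G \<longleftrightarrow> z = f x"
  shows "continuous_on S f"
  unfolding continuous_on_sequentially
proof (intro allI ballI impI, elim conjE)
  fix x a assume x: "a \<in> S" "\<forall>n::nat. x n \<in> S" "x \<longlonglongrightarrow> a"
  show "(f \<circ> x) \<longlonglongrightarrow> f a"
  proof (rule ccontr)
    assume "\<not> (f \<circ> x) \<longlonglongrightarrow> f a"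
    then obtain e where e: "0 < e" "\<not> (\<forall>\<^sub>F n in sequentially. dist (f (x n)) (f a) < e)"
      by (auto simp: tendsto_iff)
    then have "infinite {n. \<not> dist (f (x n)) (f a) < e}"
      by (auto simp: eventually_sequentially infinite_nat_iff_unbounded_le)
    from infinite_enumerate[OF this] obtain s :: "nat \<Rightarrow> nat" where
      s: "strict_mono s" "\<forall>n. e \<le> dist (f (x (s n))) (f a)"
      by (auto simp: not_less)
    have "\<forall>n. f (x (s n)) \<in> T"
      using x assms(2) by auto
    then obtain l t where lt: "l \<in> T" "strict_mono (t :: nat \<Rightarrow> nat)" "((\<lambda>n. f (x (s n))) \<circ> t) \<longlonglongrightarrow> l"
      using seq_compactE[OF compact_imp_seq_compact[OF \<open>compact T\<close>]] by metis
    have "(\<lambda>n. x (s (t n))) \<longlonglongrightarrow> a"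
      using LIMSEQ_subseq_LIMSEQ[OF LIMSEQ_subseq_LIMSEQ[OF x(3) s(1)] lt(2)] by (simp add: comp_def)
    then have lim: "(\<lambda>n. (x (s (t n)), f (x (s (t n))))) \<longlonglongrightarrow> (a, l)"
      using lt(3) by (intro tendsto_Pair) (simp_all add: comp_def)
    have "(a, l) \<in> G"
      by (rule closed_sequentially[OF \<open>closed G\<close> _ lim]) (use assms(2,4) x(2) in simp)
    then have "l = f a"
      using assms(4) x lt by simp
    moreover have "e \<le> dist l (f a)"
    proof (rule tendsto_lowerbound)
      show "(\<lambda>n. dist (f (x (s (t n)))) (f a)) \<longlonglongrightarrow> dist l (f a)"
        using lt(3) by (intro tendsto_intros) (simp add: comp_def)
    qed (use s in auto)
    ultimately show False
      using e by simp
  qed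
qed

lemma compact_dense_sequence:
  fixes S :: "'a::metric_space set"
  assumes "compact S" "S \<noteq> {}"
  obtains q :: "nat \<Rightarrow> 'a" where "\<And>y e. \<lbrakk>y \<in> S; 0 < e\<rbrakk> \<Longrightarrow> \<exists>n. dist y (q n) < e"
proof -
  have "\<exists>k. finite k \<and> S \<subseteq> (\<Union>x\<in>k. ball x (1 / real (Suc n)))" for n
    using assms(1) unfolding compact_eq_totally_bounded by simp
  then obtain k where k: "\<And>n. finite (k n)" "\<And>n. S \<subseteq> (\<Union>x\<in>k n. ball x (1 / real (Suc n)))"
    by metis
  define D where "D = (\<Union>n. k n)"
  have "countable D"
    using k(1) by (auto simp: D_def intro: countable_finite)
  moreover have "D \<noteq> {}"
    using k(2)[of 0] assms(2) by (auto simp: D_def)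
  ultimately have D: "range (from_nat_into D) = D"
    by simp
  show thesis
  proof (rule that)
    fix y and e :: real assume "y \<in> S" "0 < e"
    then obtain n where n: "1 / real (Suc n) < e"
      using nat_approx_posE by blast
    obtain x where x: "x \<in> k n" "dist x y < 1 / real (Suc n)"
      using k(2)[of n] \<open>y \<in> S\<close> by auto
    then obtain i where "x = from_nat_into D i"
      using D unfolding D_def by blast
    then have "dist y (from_nat_into D i) < e"
      using x n by (simp add: dist_commute)
    then show "\<exists>n. dist y (from_nat_into D n) < e" ..
  qed
qed

section \<open>Running minima along branches\<close>

context rooted_dendrite
begin

text \<open>Turns any continuous function into one that is antitone for the order. For continuous
  \<open>\<phi>\<close> the infimum is attained, since the branch below \<open>y\<close> is
  compact.\<close>

definition min_below :: "('a \<Rightarrow> real) \<Rightarrow> 'a \<Rightarrow> real" where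
  "min_below \<phi> y = Inf (\<phi> ` {x. x \<preceq> y})"

lemma min_below_attained:
  assumes "continuous_on Y \<phi>" "y \<in> Y"
  obtains x where "x \<preceq> y" "\<phi> x = min_below \<phi> y" "\<And>z. z \<preceq> y \<Longrightarrow> min_below \<phi> y \<le> \<phi> z"
proof -
  have "continuous_on {x. x \<preceq> y} \<phi>"
    using assms(1) by (rule continuous_on_subset) (auto simp: below_in)
  then obtain x where x: "x \<preceq> y" "\<And>z. z \<preceq> y \<Longrightarrow> \<phi> x \<le> \<phi> z"
    using continuous_attains_inf[OF compact_below, of y \<phi>] below_refl[OF assms(2)] by auto
  moreover have "\<phi> x = min_below \<phi> y"
    unfolding min_below_def using x by (intro cInf_eq_minimum[symmetric]) auto
  ultimately show thesis
    using that by metis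
qed

lemma min_below_le: "\<lbrakk>continuous_on Y \<phi>; x \<preceq> y\<rbrakk> \<Longrightarrow> min_below \<phi> y \<le> \<phi> x"
  by (rule min_below_attained[of \<phi> y]) (auto simp: below_in)

lemma min_below_antimono:
  assumes "continuous_on Y \<phi>" "x \<preceq> y"
  shows "min_below \<phi> y \<le> min_below \<phi> x"
proof -
  obtain z where "z \<preceq> x" "\<phi> z = min_below \<phi> x"
    using min_below_attained[OF assms(1) below_in(1)[OF assms(2)]] by blast
  then show ?thesis
    using min_below_le[OF assms(1) below_trans[OF _ assms(2)]] by metis
qed

text \<open>Closedness of the order gives lower semicontinuity, openness of the sets strictly above
  a point gives upper semicontinuity.\<close>

lemma continuous_min_below:
  assumes "continuous_on Y \<phi>"
  shows "continuous_on Y (min_below \<phi>)"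
proof -
  have "openin (top_of_set Y) {y \<in> Y. min_below \<phi> y > a}" for a
  proof -
    \<comment> \<open>The points \<open>y\<close> with minimum at most \<open>a\<close> form the
      projection of this compact part of the order relation.\<close>
    define C where "C = (Y \<times> Y \<inter> (\<lambda>w. \<phi> (fst w)) -` {..a}) \<inter> {(x, y). x \<preceq> y}"
    have "continuous_on (Y \<times> Y) (\<lambda>w. \<phi> (fst w))"
      by (intro continuous_on_compose2[OF assms] continuous_intros) auto
    then have "closedin (top_of_set (Y \<times> Y)) (Y \<times> Y \<inter> (\<lambda>w. \<phi> (fst w)) -` {..a})"
      by (intro continuous_closedin_preimage) auto
    then have "compact (Y \<times> Y \<inter> (\<lambda>w. \<phi> (fst w)) -` {..a})"
      by (rule closedin_compact[OF compact_Times[OF Y(1) Y(1)]])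
    then have "compact C"
      unfolding C_def by (rule compact_Int_closed[OF _ closed_below])
    then have "compact (snd ` C)"
      by (intro compact_continuous_image continuous_intros)
    then have "closed (snd ` C)"
      by (rule compact_imp_closed)
    moreover have "{y \<in> Y. min_below \<phi> y > a} = Y \<inter> - snd ` C"
    proof (intro set_eqI)
      fix y
      have "y \<in> snd ` C \<longleftrightarrow> (\<exists>x. x \<preceq> y \<and> \<phi> x \<le> a)"
        by (force simp: C_def below_in)
      moreover have "(\<exists>x. x \<preceq> y \<and> \<phi> x \<le> a) \<longleftrightarrow> min_below \<phi> y \<le> a" if "y \<in> Y"
        by (metis assms that min_below_attained order_trans)
      ultimately show "y \<in> {y \<in> Y. min_below \<phi> y > a} \<longleftrightarrow> y \<in> Y \<inter> - snd ` C"
        by (auto simp: not_le)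
    qed
    ultimately show ?thesis
      by (simp add: openin_open_Int open_Compl)
  qed
  moreover have "openin (top_of_set Y) {y \<in> Y. min_below \<phi> y < a}" for a
  proof -
    \<comment> \<open>A value below \<open>a\<close> occurs either at \<open>y\<close> itself or at
      some \<open>x\<close> strictly below \<open>y\<close>, and then every point strictly above
      \<open>x\<close> inherits it.\<close>
    have "{y \<in> Y. min_below \<phi> y < a} =
        (Y \<inter> \<phi> -` {..<a}) \<union> (\<Union>x\<in>{x \<in> Y. \<phi> x < a}. {y \<in> Y. x \<preceq> y \<and> x \<noteq> y})" (is "?L = ?R")
    proof
      show "?L \<subseteq> ?R"
      proof
        fix y assume y: "y \<in> ?L"
        then obtain x where "x \<preceq> y" "\<phi> x < a"
          using min_below_attained[OF assms, of y] by (metis (no_types, lifting) mem_Collect_eq)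
        then show "y \<in> ?R"
          using y below_in by (cases "x = y") auto
      qed
      show "?R \<subseteq> ?L"
        using min_below_le[OF assms] below_refl by (force intro: le_less_trans)
    qed
    moreover have "openin (top_of_set Y) (Y \<inter> \<phi> -` {..<a})"
      using assms by (rule continuous_openin_preimage_gen) simp
    ultimately show ?thesis
      by (auto intro!: openin_Un openin_Union openin_strictly_above)
  qed
  ultimately have "continuous_map (top_of_set Y) euclidean (min_below \<phi>)"
    unfolding continuous_map_upper_lower_semicontinuous_lt by simp
  then show ?thesis
    by simp
qed

text \<open>A weighted sum of running minima of distances to a dense sequence. If \<open>x\<close>
  is strictly below \<open>y\<close>, then \<open>y\<close> is off the closed branch below
  \<open>x\<close>, and a \<open>q n\<close> close enough to \<open>y\<close> makes the
  \<open>n\<close>-th term drop strictly.\<close>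

lemma exists_strictly_decreasing:
  obtains s :: "'a \<Rightarrow> real" where "continuous_on Y s" "\<And>y. y \<in> Y \<Longrightarrow> 0 \<le> s y"
    "\<And>x y. \<lbrakk>x \<preceq> y; x \<noteq> y\<rbrakk> \<Longrightarrow> s y < s x"
proof -
  have "Y \<noteq> {}"
    using root by auto
  then obtain q :: "nat \<Rightarrow> 'a" where q: "\<And>y e. \<lbrakk>y \<in> Y; 0 < e\<rbrakk> \<Longrightarrow> \<exists>n. dist y (q n) < e"
    by (rule compact_dense_sequence[OF Y(1)]) auto
  define d where "d = (\<lambda>n z. min 1 (dist z (q n)))"
  define t where "t = (\<lambda>n y. (1/2::real) ^ n * min_below (d n) y)"
  have contd: "continuous_on Y (d n)" for n
    unfolding d_def by (intro continuous_intros)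
  have mb: "0 \<le> min_below (d n) y" "min_below (d n) y \<le> 1" if "y \<in> Y" for n y
  proof -
    obtain x where "d n x = min_below (d n) y"
      using min_below_attained[OF contd \<open>y \<in> Y\<close>] by blast
    moreover have "0 \<le> d n x" "d n x \<le> 1"
      by (simp_all add: d_def)
    ultimately show "0 \<le> min_below (d n) y" "min_below (d n) y \<le> 1"
      by simp_all
  qed
  have geo: "summable (\<lambda>n. (1/2::real) ^ n)"
    by (simp add: summable_geometric)
  have bound: "norm (t n y) \<le> (1/2) ^ n" if "y \<in> Y" for n y
    using mb[OF that, of n] by (simp add: t_def mult_left_le)
  have summ: "summable (\<lambda>n. t n y)" if "y \<in> Y" for y
    by (rule summable_comparison_test'[OF geo bound[OF that]])
  show thesis
  proof (rule that[of "\<lambda>y. \<Sum>n. t n y"])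
    show "continuous_on Y (\<lambda>y. \<Sum>n. t n y)"
    proof (rule uniform_limit_theorem[OF _ Weierstrass_m_test[OF bound geo]])
      show "\<forall>\<^sub>F n in sequentially. continuous_on Y (\<lambda>y. \<Sum>i<n. t i y)"
        unfolding t_def by (intro always_eventually allI continuous_intros continuous_min_below contd)
    qed auto
    show "0 \<le> (\<Sum>n. t n y)" if "y \<in> Y" for y
      using mb[OF that] by (intro suminf_nonneg summ that) (simp add: t_def)
    fix x y assume xy: "x \<preceq> y" "x \<noteq> y"
    then have xyY: "x \<in> Y" "y \<in> Y"
      by (auto simp: below_in)
    have "\<not> y \<preceq> x"
      using xy below_antisym by blast
    \<comment> \<open>The cap at 1 matches the cap in \<open>d\<close>, so the threshold
      \<open>e / 2\<close> is not cut off.\<close>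
    define e where "e = min 1 (infdist y {z. z \<preceq> x})"
    have "infdist y {z. z \<preceq> x} \<noteq> 0"
      using in_closed_iff_infdist_zero[of "{z. z \<preceq> x}" y] below_refl[OF xyY(1)] \<open>\<not> y \<preceq> x\<close>
        compact_imp_closed[OF compact_below] by auto
    then have "0 < e"
      using infdist_nonneg[of y "{z. z \<preceq> x}"] by (simp add: e_def)
    then obtain n where n: "dist y (q n) < e / 2"
      using q[OF xyY(2)] half_gt_zero by blast
    have "min_below (d n) y < e / 2"
      using min_below_le[OF contd below_refl[OF xyY(2)], of n] n by (simp add: d_def)
    also have "e / 2 \<le> min_below (d n) x"
    proof -
      obtain z where z: "z \<preceq> x" "d n z = min_below (d n) x"
        using min_below_attained[OF contd \<open>x \<in> Y\<close>] by blast
      have "e \<le> dist y z"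
        using infdist_le[of z "{z. z \<preceq> x}" y] z by (simp add: e_def)
      then have "e / 2 \<le> dist z (q n)"
        using n dist_triangle[of y z "q n"] by (simp add: dist_commute)
      moreover have "e / 2 \<le> 1"
        using \<open>0 < e\<close> by (simp add: e_def)
      ultimately show ?thesis
        using z by (simp add: d_def)
    qed
    finally have "0 < t n x - t n y"
      by (simp add: t_def)
    moreover have "0 \<le> t m x - t m y" for m
      using min_below_antimono[OF contd xy(1)] by (simp add: t_def)
    ultimately have "0 < (\<Sum>n. t n x - t n y)"
      by (intro suminf_pos2[of _ n] summable_diff summ xyY)
    also have "\<dots> = (\<Sum>n. t n x) - (\<Sum>n. t n y)"
      by (intro suminf_diff[symmetric] summ xyY)
    finally show "(\<Sum>n. t n y) < (\<Sum>n. t n x)"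
      by simp
  qed
qed

text \<open>The running minimum \<open>m\<close> of the distance to \<open>E\<close> vanishes
  exactly on \<open>E\<close>, because only the top of a branch can lie in \<open>E\<close>. It may
  be constant along pieces of a branch; the factor \<open>1 + s y\<close> makes it strict where it
  is positive.\<close>

lemma exists_height:
  assumes "closed E" "E \<noteq> {}" "\<And>x y. \<lbrakk>x \<preceq> y; x \<noteq> y\<rbrakk> \<Longrightarrow> x \<notin> E"
  obtains h :: "'a \<Rightarrow> real" where "continuous_on Y h" "\<And>y. y \<in> Y \<Longrightarrow> 0 \<le> h y"
    "\<And>y. y \<in> Y \<Longrightarrow> h y = 0 \<longleftrightarrow> y \<in> E" "\<And>x y. \<lbrakk>x \<preceq> y; x \<noteq> y\<rbrakk> \<Longrightarrow> h y < h x"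
proof -
  obtain s :: "'a \<Rightarrow> real" where s: "continuous_on Y s" "\<And>y. y \<in> Y \<Longrightarrow> 0 \<le> s y"
    "\<And>x y. \<lbrakk>x \<preceq> y; x \<noteq> y\<rbrakk> \<Longrightarrow> s y < s x"
    using exists_strictly_decreasing by blast
  define m where "m = min_below (\<lambda>z. infdist z E)"
  have cont: "continuous_on Y (\<lambda>z. infdist z E)"
    by (intro continuous_intros)
  have m0: "0 \<le> m y" "m y = 0 \<longleftrightarrow> y \<in> E" if "y \<in> Y" for y
  proof -
    obtain x where x: "x \<preceq> y" "infdist x E = m y" "\<And>z. z \<preceq> y \<Longrightarrow> m y \<le> infdist z E"
      using min_below_attained[OF cont \<open>y \<in> Y\<close>] unfolding m_def by blast
    show "0 \<le> m y"
      using x(2) infdist_nonneg by metis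
    have "m y = 0" if "y \<in> E"
      using x(3)[OF below_refl[OF \<open>y \<in> Y\<close>]] that \<open>0 \<le> m y\<close> by simp
    moreover have "y \<in> E" if "m y = 0"
    proof -
      have "x \<in> E"
        using in_closed_iff_infdist_zero[OF assms(1,2)] that x by simp
      then show ?thesis
        using assms(3)[OF x(1)] by blast
    qed
    ultimately show "m y = 0 \<longleftrightarrow> y \<in> E"
      by blast
  qed
  show thesis
  proof (rule that[of "\<lambda>y. m y * (1 + s y)"])
    show "continuous_on Y (\<lambda>y. m y * (1 + s y))"
      unfolding m_def by (intro continuous_intros continuous_min_below s(1))
    show "0 \<le> m y * (1 + s y)" if "y \<in> Y" for y
      using m0[OF that] s(2)[OF that] by simp
    show "m y * (1 + s y) = 0 \<longleftrightarrow> y \<in> E" if "y \<in> Y" for y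
      using m0[OF that] s(2)[OF that] by simp
    fix x y assume xy: "x \<preceq> y" "x \<noteq> y"
    then have "x \<in> Y" "y \<in> Y"
      by (auto simp: below_in)
    have "0 < m x"
      using m0[OF \<open>x \<in> Y\<close>] assms(3)[OF xy] by simp
    have "m y * (1 + s y) \<le> m x * (1 + s y)"
      using min_below_antimono[OF cont xy(1)] s(2)[OF \<open>y \<in> Y\<close>] by (intro mult_right_mono) (auto simp: m_def)
    also have "\<dots> < m x * (1 + s x)"
      using s(3)[OF xy] \<open>0 < m x\<close> by simp
    finally show "m y * (1 + s y) < m x * (1 + s x)" .
  qed
qed

end

section \<open>Truncation and the extension\<close>

text \<open>The infimum of affine functions is concave, hence continuous in the interior.\<close>

lemma continuous_INF_affine:
  fixes \<rho> :: "real \<Rightarrow> real" and H :: real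
  assumes \<rho>: "\<And>c. 0 < c \<Longrightarrow> 0 < \<rho> c" and "0 \<le> H"
  shows "continuous_on {0..} (\<lambda>t. INF c\<in>{0<..}. c + H * t / \<rho> c)" (is "continuous_on _ ?\<omega>")
    and "(INF c\<in>{0<..}. c + H * 0 / \<rho> c) = 0"
    and "\<And>t. 0 \<le> t \<Longrightarrow> 0 \<le> (INF c\<in>{0<..}. c + H * t / \<rho> c)"
proof -
  have nonneg: "0 \<le> c + H * t / \<rho> c" if "0 \<le> t" "0 < c" for t c
    using \<rho>[OF \<open>0 < c\<close>] \<open>0 \<le> H\<close> that by simp
  have bdd: "bdd_below ((\<lambda>c. c + H * t / \<rho> c) ` {0<..})" if "0 \<le> t" for t
    using nonneg[OF that] by (intro bdd_belowI[of _ 0]) auto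
  have upper: "?\<omega> t \<le> c + H * t / \<rho> c" if "0 \<le> t" "0 < c" for t c
    using that by (intro cINF_lower bdd) auto
  show lower: "0 \<le> ?\<omega> t" if "0 \<le> t" for t
    using nonneg[OF that] by (intro cINF_greatest) auto
  have "?\<omega> 0 \<le> c" if "0 < c" for c
    using upper[of 0 c] that by simp
  then show zero: "?\<omega> 0 = 0"
    using lower[of 0] dense_ge[of 0 "?\<omega> 0"] by force
  have "convex_on {0<..} (\<lambda>t. - ?\<omega> t)"
  proof (rule convex_onI)
    fix u x y :: real assume u: "0 < u" "u < 1" and xy: "x \<in> {0<..}" "y \<in> {0<..}"
    have "(1 - u) * ?\<omega> x + u * ?\<omega> y \<le> ?\<omega> ((1 - u) * x + u * y)"
    proof (rule cINF_greatest)
      fix c :: real assume c: "c \<in> {0<..}"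
      have "(1 - u) * ?\<omega> x + u * ?\<omega> y \<le> (1 - u) * (c + H * x / \<rho> c) + u * (c + H * y / \<rho> c)"
        using u xy c by (intro add_mono mult_left_mono upper) auto
      also have "\<dots> = c + H * ((1 - u) * x + u * y) / \<rho> c"
        by (simp add: algebra_simps add_divide_distrib diff_divide_distrib)
      finally show "(1 - u) * ?\<omega> x + u * ?\<omega> y \<le> c + H * ((1 - u) * x + u * y) / \<rho> c" .
    qed simp
    then show "- ?\<omega> ((1 - u) *\<^sub>R x + u *\<^sub>R y) \<le> (1 - u) * (- ?\<omega> x) + u * (- ?\<omega> y)"
      by simp
  qed simp
  then have "continuous_on {0<..} (\<lambda>t. - (- ?\<omega> t))"
    by (intro continuous_on_minus convex_on_continuous) auto
  then have pos: "continuous_on {0<..} ?\<omega>"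
    by simp
  show "continuous_on {0..} ?\<omega>"
    unfolding continuous_on_eq_continuous_within
  proof
    fix t :: real assume "t \<in> {0..}"
    then consider "0 < t" | "t = 0"
      by fastforce
    then show "continuous (at t within {0..}) ?\<omega>"
    proof cases
      case 1
      then have "isCont ?\<omega> t"
        using pos by (simp add: continuous_on_eq_continuous_at)
      then show ?thesis
        by (rule continuous_at_imp_continuous_at_within)
    next
      \<comment> \<open>Zero is a boundary point, where concavity does not suffice; the single
        affine function with \<open>c = e/2\<close> bounds the infimum there.\<close>
      case 2
      have "(?\<omega> \<longlongrightarrow> 0) (at 0 within {0..})"
      proof (rule tendstoI)
        fix e :: real assume "0 < e"
        have "((\<lambda>t. e/2 + H * t / \<rho> (e/2)) \<longlongrightarrow> e/2 + H * 0 / \<rho> (e/2)) (at 0 within {0..})"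
          using \<rho>[of "e/2"] \<open>0 < e\<close> by (intro tendsto_intros) auto
        then have "\<forall>\<^sub>F t in at 0 within {0..}. e/2 + H * t / \<rho> (e/2) < e"
          using \<open>0 < e\<close> by (elim order_tendstoD(2)) simp
        moreover have "\<forall>\<^sub>F t in at (0::real) within {0..}. 0 \<le> t"
          by (auto simp: eventually_at_filter)
        ultimately show "\<forall>\<^sub>F t in at 0 within {0..}. dist (?\<omega> t) 0 < e"
        proof eventually_elim
          case (elim t)
          then show ?case
            using upper[of t "e/2"] lower[of t] \<open>0 < e\<close> by (simp add: dist_real_def)
        qed
      qed
      then show ?thesis
        using 2 zero by (simp add: continuous_within)
    qed
  qed
qed

section \<open>Truncation at a height\<close>

locale dendrite_height = rooted_dendrite +
  fixes h :: "'a \<Rightarrow> real"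
  assumes cont_height: "continuous_on Y h"
    and height_less: "\<And>x y. \<lbrakk>x \<preceq> y; x \<noteq> y\<rbrakk> \<Longrightarrow> h y < h x"
begin

lemma height_le: "x \<preceq> y \<Longrightarrow> h y \<le> h x"
  using height_less[of x y] by (cases "x = y") auto

lemma height_le_root: "y \<in> Y \<Longrightarrow> h y \<le> h r"
  by (simp add: height_le root_below)

lemma below_if_height_le:
  assumes "x \<preceq> y" "x' \<preceq> y" "h x' \<le> h x"
  shows "x \<preceq> x'"
proof (rule ccontr)
  assume "\<not> x \<preceq> x'"
  then have "x' \<preceq> x" "x' \<noteq> x"
    using below_linear[OF assms(1,2)] below_refl below_in(1)[OF assms(2)] by auto
  then show False
    using height_less assms(3) by fastforce
qed

lemma below_height_unique:
  assumes "x \<preceq> y" "x' \<preceq> y" "h x = h x'"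
  shows "x = x'"
  using below_if_height_le[OF assms(1,2)] below_if_height_le[OF assms(2,1)] assms(3) below_antisym by simp

text \<open>An intermediate value theorem on a branch without parametrizing it: \<open>z\<close> has
  the least height at or above \<open>c\<close>, \<open>w\<close> the greatest at or below
  \<open>c\<close>. If neither equals \<open>c\<close>, density puts a point strictly between them,
  against these choices.\<close>

lemma below_height_exists:
  assumes "y \<in> Y" "h y \<le> c" "c \<le> h r"
  obtains z where "z \<preceq> y" "h z = c"
proof -
  have cont: "continuous_on {x. x \<preceq> y} h"
    using cont_height by (rule continuous_on_subset) (auto simp: below_in)
  have pre: "compact ({x. x \<preceq> y} \<inter> h -` K)" if "closed K" for K
    by (rule closedin_compact[OF compact_below continuous_closedin_preimage[OF cont that]])
  have cont': "continuous_on ({x. x \<preceq> y} \<inter> h -` K) h" for K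
    using cont by (rule continuous_on_subset) auto
  have ne: "{x. x \<preceq> y} \<inter> h -` {c..} \<noteq> {}" "{x. x \<preceq> y} \<inter> h -` {..c} \<noteq> {}"
    using assms root_below[OF assms(1)] below_refl[OF assms(1)] by auto
  obtain z where z: "z \<preceq> y" "c \<le> h z" "\<And>x. x \<preceq> y \<Longrightarrow> c \<le> h x \<Longrightarrow> h z \<le> h x"
    using continuous_attains_inf[OF pre[OF closed_atLeast] ne(1) cont'] by auto
  obtain w where w: "w \<preceq> y" "h w \<le> c" "\<And>x. x \<preceq> y \<Longrightarrow> h x \<le> c \<Longrightarrow> h x \<le> h w"
    using continuous_attains_sup[OF pre[OF closed_atMost] ne(2) cont'] by auto
  have "h z = c \<or> h w = c"
  proof (rule ccontr)
    assume "\<not> (h z = c \<or> h w = c)"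
    then have "h w < c" "c < h z"
      using z w by auto
    then have "z \<preceq> w" "z \<noteq> w"
      using below_if_height_le[OF z(1) w(1)] by auto
    then obtain p where p: "z \<preceq> p" "z \<noteq> p" "p \<preceq> w" "p \<noteq> w"
      using below_dense by blast
    then have "h p < h z" "h w < h p"
      using height_less by auto
    moreover have "p \<preceq> y"
      using p(3) w(1) below_trans by blast
    ultimately show False
      using z(3)[of p] w(3)[of p] by linarith
  qed
  with z(1) w(1) that show thesis
    by blast
qed

text \<open>The point is unique because heights are injective on a branch; it exists for
  \<open>c \<le> h r\<close>. The \<open>max\<close> makes truncation the identity at levels up to
  \<open>h y\<close>.\<close>

definition trunc :: "'a \<Rightarrow> real \<Rightarrow> 'a" where
  "trunc y c = (SOME z. z \<preceq> y \<and> h z = max (h y) c)"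

lemma trunc:
  assumes "y \<in> Y" "c \<le> h r"
  shows "trunc y c \<preceq> y" "h (trunc y c) = max (h y) c"
proof -
  have "\<exists>z. z \<preceq> y \<and> h z = max (h y) c"
    using below_height_exists[OF assms(1), of "max (h y) c"] height_le_root[OF assms(1)] assms(2) by auto
  from someI_ex[OF this] show "trunc y c \<preceq> y" "h (trunc y c) = max (h y) c"
    by (auto simp: trunc_def)
qed

lemma trunc_unique: "\<lbrakk>z \<preceq> y; h z = max (h y) c; c \<le> h r\<rbrakk> \<Longrightarrow> trunc y c = z"
  using trunc[of y c] below_height_unique below_in(2) by metis

lemma trunc_self: "\<lbrakk>y \<in> Y; c \<le> h y\<rbrakk> \<Longrightarrow> trunc y c = y"
  using trunc_unique[of y y c] below_refl height_le_root[of y] by simp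

lemma height_eq_root:
  assumes "y \<in> Y" "h y = h r"
  shows "y = r"
  using below_height_unique[OF below_refl root_below] assms by blast

text \<open>The graph is cut out by the closed order relation and a continuous equation between
  heights, and the values stay in the compact set \<open>Y\<close>.\<close>

lemma continuous_trunc: "continuous_on (Y \<times> {..h r}) (\<lambda>(y, c). trunc y c)"
proof (rule continuous_on_compact_closed_graph[OF Y(1)])
  define K where "K = (Y \<times> {..h r}) \<times> Y"
  have "continuous_on K (\<lambda>w. h (snd w) - max (h (fst (fst w))) (snd (fst w)))"
    unfolding K_def by (intro continuous_intros continuous_on_compose2[OF cont_height]) auto
  moreover have "closed K"
    unfolding K_def by (intro closed_Times compact_imp_closed[OF Y(1)] closed_atMost)
  ultimately have "closed (K \<inter> (\<lambda>w. h (snd w) - max (h (fst (fst w))) (snd (fst w))) -` {0})"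
    by (rule continuous_closed_preimage) simp
  moreover have "closed ((\<lambda>w. (snd w, fst (fst w))) -` {(x, y). x \<preceq> y} :: (('a \<times> real) \<times> 'a) set)"
    by (intro closed_vimage closed_below continuous_intros)
  ultimately show "closed ((K \<inter> (\<lambda>w. h (snd w) - max (h (fst (fst w))) (snd (fst w))) -` {0}) \<inter>
      (\<lambda>w. (snd w, fst (fst w))) -` {(x, y). x \<preceq> y})"
    by (rule closed_Int)
  show "(w, z) \<in> (K \<inter> (\<lambda>w. h (snd w) - max (h (fst (fst w))) (snd (fst w))) -` {0}) \<inter>
      (\<lambda>w. (snd w, fst (fst w))) -` {(x, y). x \<preceq> y} \<longleftrightarrow> z = (case w of (y, c) \<Rightarrow> trunc y c)"
    if "w \<in> Y \<times> {..h r}" "z \<in> Y" for w z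
    using that trunc trunc_unique by (auto simp: K_def)
qed (auto dest: trunc below_in)

text \<open>The truncated point is strictly below \<open>p\<close>, and the points strictly above it
  form an open set.\<close>

lemma trunc_locally_constant:
  assumes "p \<in> Y" "h p < c" "c \<le> h r"
  obtains W where "open W" "p \<in> W" "\<And>a. a \<in> Y \<inter> W \<Longrightarrow> trunc p c \<preceq> a"
proof -
  define x where "x = trunc p c"
  have x: "x \<preceq> p" "h x = c"
    using trunc[OF assms(1,3)] assms(2) by (auto simp: x_def)
  then have "p \<in> {y \<in> Y. x \<preceq> y \<and> x \<noteq> y}"
    using assms by auto
  then show thesis
    using that openin_strictly_above[of x] unfolding openin_open x_def by blast
qed

text \<open>\<open>d\<close> is a Lebesgue number of the cover of \<open>E\<close> by sets on which
  \<open>f\<close> stays above one point of height \<open>c\<close>. One \<open>d\<close> serves all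
  levels from \<open>c\<close> on.\<close>

lemma trunc_uniform:
  assumes "continuous_on E f" "compact E" "\<And>e. e \<in> E \<Longrightarrow> f e \<in> Y \<and> h (f e) = 0"
    and "0 < c"
  shows "\<exists>d>0. \<forall>a\<in>E. \<forall>b\<in>E. \<forall>c'\<in>{c..h r}. dist a b < d \<longrightarrow> trunc (f a) c' = trunc (f b) c'"
proof (cases "c \<le> h r")
  case False
  then show ?thesis
    by (intro exI[of _ 1]) auto
next
  case True
  have "\<exists>W. open W \<and> p \<in> W \<and> (\<forall>a\<in>E \<inter> W. trunc (f p) c \<preceq> f a)" if p: "p \<in> E" for p
  proof -
    obtain W where W: "open W" "f p \<in> W" "\<And>a. a \<in> Y \<inter> W \<Longrightarrow> trunc (f p) c \<preceq> a"
      using trunc_locally_constant[of "f p" c] assms(3)[OF p] assms(4) True by auto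
    have "openin (top_of_set E) (E \<inter> f -` W)"
      using assms(1) W(1) by (rule continuous_openin_preimage_gen)
    then obtain V where "open V" "E \<inter> f -` W = E \<inter> V"
      unfolding openin_open by blast
    then show ?thesis
      using W(2,3) assms(3) p by (intro exI[of _ V]) blast
  qed
  then have "\<forall>p\<in>E. \<exists>W. open W \<and> p \<in> W \<and> (\<forall>a\<in>E \<inter> W. trunc (f p) c \<preceq> f a)"
    by blast
  from bchoice[OF this] obtain W where W: "\<And>p. p \<in> E \<Longrightarrow> open (W p) \<and> p \<in> W p"
      "\<And>p a. \<lbrakk>p \<in> E; a \<in> E \<inter> W p\<rbrakk> \<Longrightarrow> trunc (f p) c \<preceq> f a"
    by auto
  have "E \<subseteq> \<Union>(W ` E)" "\<And>G. G \<in> W ` E \<Longrightarrow> open G"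
    using W(1) by auto
  then obtain d where d: "0 < d" "\<And>x. x \<in> E \<Longrightarrow> \<exists>G\<in>W ` E. ball x d \<subseteq> G"
    using Heine_Borel_lemma[OF \<open>compact E\<close>, of "W ` E"] by blast
  show ?thesis
  proof (intro exI[of _ d] conjI ballI impI)
    fix a b c' assume ab: "a \<in> E" "b \<in> E" "dist a b < d" and "c' \<in> {c..h r}"
    then have c': "c \<le> c'" "c' \<le> h r"
      by auto
    obtain p where p: "p \<in> E" "ball a d \<subseteq> W p"
      using d(2)[OF ab(1)] by blast
    define x where "x = trunc (f p) c"
    have "a \<in> ball a d" "b \<in> ball a d"
      using ab d(1) by auto
    then have x: "x \<preceq> f a" "x \<preceq> f b"
      unfolding x_def using W(2)[OF p(1)] p(2) ab by blast+
    have hx: "h x = c"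
      using trunc(2)[of "f p" c] assms(3)[OF p(1)] True assms(4) by (simp add: x_def)
    define z where "z = trunc (f a) c'"
    have z: "z \<preceq> f a" "h z = c'"
      using trunc[of "f a" c'] assms(3)[OF ab(1)] assms(4) c' by (auto simp: z_def)
    \<comment> \<open>Both branches contain \<open>x\<close> and hence agree below it, where all
      truncations at levels at least \<open>c\<close> lie.\<close>
    then have "z \<preceq> x"
      using below_if_height_le[OF z(1) x(1)] hx c' by simp
    then have "z \<preceq> f b"
      using below_trans x(2) by blast
    then show "trunc (f a) c' = trunc (f b) c'"
      using trunc_unique[of z "f b" c'] assms(3)[OF ab(2)] z assms(4) c' by (simp add: z_def)
  qed (fact d)
qed

lemma eventually_fixed_if_height_doubles:
  assumes "F \<in> Y \<rightarrow> Y" "\<And>y. y \<in> Y \<Longrightarrow> min (h r) (2 * h y) \<le> h (F y)"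
    and "0 \<le> h r" "y \<in> Y" "0 < h y"
  shows "eventually_fixed F y"
proof -
  have top: "z = r" if "z \<in> Y" "h r \<le> h z" for z
    using that height_le_root[of z] height_eq_root[of z] by simp
  have iter: "(F ^^ n) y \<in> Y \<and> min (h r) (2 ^ n * h y) \<le> h ((F ^^ n) y)" for n
  proof (induction n)
    case (Suc n)
    then have "min (h r) (2 * h ((F ^^ n) y)) \<le> h (F ((F ^^ n) y))"
      using assms(2) by blast
    then have "min (h r) (2 ^ Suc n * h y) \<le> h ((F ^^ Suc n) y)"
      using Suc assms(3) by (auto simp: min_def split: if_splits)
    then show ?case
      using Suc assms(1) by auto
  qed (use assms(4) in auto)
  obtain n where "h r / h y < 2 ^ n"
    using real_arch_pow[of 2 "h r / h y"] by auto
  then have "h r \<le> h ((F ^^ n) y)"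
    using iter[of n] assms(5) by (simp add: divide_less_eq)
  then have "(F ^^ n) y = r"
    using top iter by blast
  \<comment> \<open>With \<open>0 \<le> h r\<close> the doubling bound at \<open>r\<close> gives
    maximal height to \<open>F r\<close>, and only the root has it.\<close>
  moreover have "F r = r"
    using assms(1) assms(2)[OF root] root assms(3) by (intro top) auto
  ultimately show ?thesis
    unfolding eventually_fixed_def by (intro exI[of _ n]) simp
qed

section \<open>Construction of the extension\<close>

lemma extension_by_truncation:
  assumes "compact E" "E \<noteq> {}" "E \<subseteq> Y" "\<And>y. y \<in> Y \<Longrightarrow> 0 \<le> h y"
    and h0: "\<And>y. y \<in> Y \<Longrightarrow> h y = 0 \<longleftrightarrow> y \<in> E"
    and contf: "continuous_on E f" and fE: "f \<in> E \<rightarrow> E"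
  obtains F where "continuous_on Y F" "F \<in> Y \<rightarrow> Y" "\<And>y. y \<in> E \<Longrightarrow> F y = f y"
    "\<And>y. y \<in> Y - E \<Longrightarrow> eventually_fixed F y"
proof -
  define H where "H = h r"
  have "0 \<le> H"
    using assms(4) root by (simp add: H_def)
  have fY: "f e \<in> Y" "h (f e) = 0" if "e \<in> E" for e
    using that fE assms(3) h0 by auto
  have "\<forall>c\<in>{0<..}. \<exists>d>0. \<forall>a\<in>E. \<forall>b\<in>E. \<forall>c'\<in>{c..H}. dist a b < d \<longrightarrow> trunc (f a) c' = trunc (f b) c'"
    unfolding H_def by (intro ballI trunc_uniform[OF contf assms(1)]) (use fY in auto)
  from bchoice[OF this] obtain \<rho> where level: "\<forall>c\<in>{0<..}. 0 < \<rho> c \<and>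
      (\<forall>a\<in>E. \<forall>b\<in>E. \<forall>c'\<in>{c..H}. dist a b < \<rho> c \<longrightarrow> trunc (f a) c' = trunc (f b) c')" ..
  have \<rho>: "0 < \<rho> c" if "0 < c" for c
    using bspec[OF level, of c] that by (metis greaterThan_iff)
  have uniform: "trunc (f a) c' = trunc (f b) c'"
    if "0 < c" "a \<in> E" "b \<in> E" "c \<le> c'" "c' \<le> H" "dist a b < \<rho> c" for a b c c'
  proof -
    have "c \<in> {0<..}" "c' \<in> {c..H}"
      using that by auto
    from level[THEN bspec, OF this(1), THEN conjunct2, rule_format, OF that(2,3) this(2) that(6)]
    show ?thesis .
  qed
  \<comment> \<open>\<open>\<omega> t\<close> is a continuous bound for the level at which all points \<open>f e\<close> with \<open>e\<close> in a subset of \<open>E\<close>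
    of diameter \<open>t\<close> have the same truncation.\<close>
  define \<omega> where "\<omega> = (\<lambda>t. INF c\<in>{0<..}. c + H * t / \<rho> c)"
  have \<omega>_cont: "continuous_on {0..} \<omega>"
    unfolding \<omega>_def by (rule continuous_INF_affine(1)[OF \<rho> \<open>0 \<le> H\<close>])
  have \<omega>_zero: "\<omega> 0 = 0"
    unfolding \<omega>_def by (rule continuous_INF_affine(2)[OF \<rho> \<open>0 \<le> H\<close>])
  have \<omega>_nonneg: "0 \<le> \<omega> t" if "0 \<le> t" for t
    unfolding \<omega>_def by (rule continuous_INF_affine(3)[OF \<rho> \<open>0 \<le> H\<close> that])
  have agree: "trunc (f a) c' = trunc (f b) c'"
    if ab: "a \<in> E" "b \<in> E" "dist a b \<le> t" and c': "\<omega> t < c'" "c' \<le> H" for a b t c'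
  proof -
    have "\<exists>c>0. c + H * t / \<rho> c < c'"
    proof (rule ccontr)
      assume "\<not> (\<exists>c>0. c + H * t / \<rho> c < c')"
      then have "c' \<le> c + H * t / \<rho> c" if "0 < c" for c
        using that not_less by blast
      then have "c' \<le> \<omega> t"
        unfolding \<omega>_def by (intro cINF_greatest) auto
      with c' show False
        by simp
    qed
    then obtain c where c: "0 < c" "c + H * t / \<rho> c < c'"
      by blast
    have "0 \<le> t"
      using ab(3) zero_le_dist order_trans by blast
    \<comment> \<open>If \<open>\<rho> c \<le> t\<close>, the penalty term
      \<open>H * t / \<rho> c\<close> alone would be at least \<open>H\<close>, hence at least
      \<open>c'\<close>.\<close>
    have "t < \<rho> c"
    proof (rule ccontr)
      assume "\<not> t < \<rho> c"
      then have "H * 1 \<le> H * (t / \<rho> c)"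
        using \<rho>[OF c(1)] \<open>0 \<le> H\<close> by (intro mult_left_mono) simp_all
      then show False
        using c c' by simp
    qed
    moreover have "c \<le> c'"
    proof -
      have "0 \<le> H * t / \<rho> c"
        using \<rho>[OF c(1)] \<open>0 \<le> H\<close> \<open>0 \<le> t\<close> by simp
      then show ?thesis
        using c(2) by linarith
    qed
    ultimately show ?thesis
      using uniform[OF c(1) ab(1,2)] ab(3) c'(2) by simp
  qed
  have "\<exists>e\<in>E. dist y e = infdist y E" for y
  proof -
    have "continuous_on E (\<lambda>e. dist y e)"
      by (intro continuous_intros)
    then obtain e where e: "e \<in> E" "\<And>e'. e' \<in> E \<Longrightarrow> dist y e \<le> dist y e'"
      using continuous_attains_inf[OF assms(1,2)] by blast
    then have "dist y e = infdist y E"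
      unfolding infdist_notempty[OF assms(2)] by (intro cInf_eq_minimum[symmetric]) auto
    with e show ?thesis
      by blast
  qed
  then obtain s where s: "\<And>y. s y \<in> E" "\<And>y. dist y (s y) = infdist y E"
    by metis
  have sE: "s e = e" if "e \<in> E" for e
    using s(2)[of e] that by simp
  \<comment> \<open>The factor 4 bounds the distance between nearest points chosen for neighbouring
    points off \<open>E\<close>. The summand \<open>2 * h y\<close> lifts the level strictly above
    the \<open>\<omega>\<close> bound off \<open>E\<close> and doubles heights; the cap
    \<open>H\<close> keeps the level admissible.\<close>
  define C where "C = (\<lambda>y. min H (\<omega> (4 * infdist y E) + 2 * h y))"
  have CH: "C y \<le> h r" for y
    by (simp add: C_def H_def)
  have CE: "C e = 0" if "e \<in> E" for e
    using that h0[of e] assms(3) \<open>0 \<le> H\<close> \<omega>_zero by (auto simp: C_def)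
  have contC: "continuous_on Y C"
    unfolding C_def
    by (intro continuous_intros cont_height continuous_on_compose2[OF \<omega>_cont]) (auto simp: infdist_nonneg)
  define F where "F = (\<lambda>y. trunc (f (s y)) (C y))"
  have F: "F y \<preceq> f (s y)" "h (F y) = max 0 (C y)" for y
    using trunc[OF fY(1)[OF s(1)] CH] fY(2)[OF s(1)] by (simp_all add: F_def)
  have root_trunc: "trunc p H = r" if "p \<in> Y" for p
    using that by (intro trunc_unique) (auto simp: H_def root_below height_le_root)
  show thesis
  proof (rule that)
    show "continuous_on Y F"
      unfolding continuous_on_def
    proof
      fix y assume y: "y \<in> Y"
      have limC: "(C \<longlongrightarrow> C y) (at y within Y)"
        using contC y by (simp add: continuous_on_def)
      have lim: "((\<lambda>x. trunc (g x) (C x)) \<longlongrightarrow> trunc p (C y)) (at y within Y)"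
        if "(g \<longlongrightarrow> p) (at y within Y)" "p \<in> Y" "\<And>x. g x \<in> Y" for g p
        using continuous_on_tendsto_compose[OF continuous_trunc tendsto_Pair[OF that(1) limC]] that CH by simp
      show "(F \<longlongrightarrow> F y) (at y within Y)"
      proof (cases "y \<in> E")
        case True
        have "(s \<longlongrightarrow> y) (at y within Y)"
        proof (rule tendstoI)
          fix e :: real assume "0 < e"
          have "dist (s x) y < e" if "dist x y < e / 2" for x
          proof -
            have "dist x (s x) \<le> dist x y"
              unfolding s(2) by (rule infdist_le[OF True])
            then show ?thesis
              using that dist_triangle[of "s x" y x] by (simp add: dist_commute)
          qed
          then show "\<forall>\<^sub>F x in at y within Y. dist (s x) y < e"
            unfolding eventually_at using \<open>0 < e\<close> by (intro exI[of _ "e / 2"]) auto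
        qed
        then have "((\<lambda>x. f (s x)) \<longlongrightarrow> f y) (at y within Y)"
          by (rule continuous_on_tendsto_compose[OF contf]) (use True s in auto)
        then have "((\<lambda>x. trunc (f (s x)) (C x)) \<longlongrightarrow> trunc (f y) (C y)) (at y within Y)"
          by (rule lim) (use fY True s in auto)
        then show ?thesis
          by (simp add: F_def sE[OF True])
      next
        case False
        \<comment> \<open>Within half the distance to \<open>E\<close>, \<open>dist x y\<close> is
          smaller than \<open>infdist x E\<close>, which yields the factor 4 below.\<close>
        define d where "d = infdist y E / 2"
        have "0 < d"
          using in_closed_iff_infdist_zero[OF compact_imp_closed[OF assms(1)] assms(2), of y] False
            infdist_nonneg[of y E] by (simp add: d_def)
        have "trunc (f (s y)) (C x) = F x" if x: "x \<in> Y" "dist x y < d" for x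
        proof -
          have tri: "infdist y E \<le> infdist x E + dist x y"
            using infdist_triangle[of y E x] by (simp add: dist_commute)
          then have "dist x y < infdist x E"
            using x by (simp add: d_def)
          then have "dist (s y) (s x) \<le> 4 * infdist x E"
            using tri s(2)[of x] s(2)[of y] dist_triangle[of "s y" "s x" y] dist_triangle[of y "s x" x]
            by (simp add: dist_commute)
          note close = agree[OF s(1) s(1) this]
          have "x \<notin> E"
            using \<open>dist x y < infdist x E\<close> zero_le_dist[of x y] by auto
          then have "0 < h x"
            using assms(4)[OF x(1)] h0[OF x(1)] by simp
          show ?thesis
          \<comment> \<open>At the cap every truncation is the root. Below the cap,
            \<open>0 < h x\<close> puts the level strictly above the \<open>\<omega>\<close> bound,
            so \<open>s x\<close> and \<open>s y\<close> give the same truncation.\<close>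
          proof (cases "C x = H")
            case True
            then show ?thesis
              using root_trunc fY(1) s(1) by (simp add: F_def)
          next
            case False
            then have "\<omega> (4 * infdist x E) < C x" "C x \<le> H"
              using \<open>0 < h x\<close> by (auto simp: C_def min_def split: if_splits)
            then show ?thesis
              using close by (simp add: F_def)
          qed
        qed
        then have "\<forall>\<^sub>F x in at y within Y. trunc (f (s y)) (C x) = F x"
          unfolding eventually_at using \<open>0 < d\<close> by (intro exI[of _ d]) auto
        moreover have "((\<lambda>x. trunc (f (s y)) (C x)) \<longlongrightarrow> F y) (at y within Y)"
          unfolding F_def by (rule lim) (use fY s in auto)
        ultimately show ?thesis
          by (rule Lim_transform_eventually[rotated])
      qed
    qed
    show FY: "F \<in> Y \<rightarrow> Y"
      using F(1) below_in(1) by blast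
    show "F y = f y" if "y \<in> E" for y
      using that fY CE sE trunc_self[of "f y" 0] by (simp add: F_def)
    show "eventually_fixed F y" if "y \<in> Y - E" for y
    proof (rule eventually_fixed_if_height_doubles[OF FY])
      show "min (h r) (2 * h y) \<le> h (F y)" if "y \<in> Y" for y
        using F(2)[of y] \<omega>_nonneg[of "4 * infdist y E"] infdist_nonneg[of y E] by (simp add: C_def H_def min_def max_def)
      show "0 < h y"
        using that assms(4)[of y] h0[of y] by fastforce
    qed (use that \<open>0 \<le> H\<close> H_def in auto)
  qed
qed

end

theorem theoremB:
  fixes Y :: "'a::metric_space set" and f :: "'a \<Rightarrow> 'a"
  assumes "dendrite Y"
    and "closedin (top_of_set Y) (endpoints Y)"
    and "continuous_on (endpoints Y) f"
    and "f \<in> endpoints Y \<rightarrow> endpoints Y"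
  shows "\<exists>F :: 'a \<Rightarrow> 'a.
           continuous_on Y F \<and> F \<in> Y \<rightarrow> Y \<and>
           (\<forall>y\<in>endpoints Y. F y = f y) \<and>
           (\<forall>y\<in>Y - endpoints Y. eventually_fixed F y)"
proof -
  have sub: "endpoints Y \<subseteq> Y"
    by (auto simp: endpoints_def)
  \<comment> \<open>The construction requires a root outside the endpoint set and a nonempty
    endpoint set. If every point is an endpoint, \<open>f\<close> itself works; if there are none, a
    constant map does, so the existence of endpoints need not be shown.\<close>
  consider "endpoints Y = Y" | r where "r \<in> Y" "r \<notin> endpoints Y" "endpoints Y = {}"
    | r where "r \<in> Y" "r \<notin> endpoints Y" "endpoints Y \<noteq> {}"
    using sub by blast
  then show ?thesis
  proof cases
    case 1
    then show ?thesis
      using assms by (intro exI[of _ f]) auto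
  next
    case 2
    then show ?thesis
      by (intro exI[of _ "\<lambda>_. r"]) (auto simp: eventually_fixed_def intro: exI[of _ 1])
  next
    case 3
    interpret rooted_dendrite Y r
      by standard (use assms 3 in auto)
    have "compact (endpoints Y)"
      using assms(2) Y(1) closedin_compact by blast
    then have "closed (endpoints Y)"
      by (rule compact_imp_closed)
    then obtain h :: "'a \<Rightarrow> real" where h: "continuous_on Y h" "\<And>y. y \<in> Y \<Longrightarrow> 0 \<le> h y"
      "\<And>y. y \<in> Y \<Longrightarrow> h y = 0 \<longleftrightarrow> y \<in> endpoints Y" "\<And>x y. \<lbrakk>below x y; x \<noteq> y\<rbrakk> \<Longrightarrow> h y < h x"
      using exists_height[of "endpoints Y"] 3 strictly_below_not_endpoint by metis
    interpret dendrite_height Y r h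
      by standard (use h in auto)
    obtain F where "continuous_on Y F" "F \<in> Y \<rightarrow> Y" "\<And>y. y \<in> endpoints Y \<Longrightarrow> F y = f y"
      "\<And>y. y \<in> Y - endpoints Y \<Longrightarrow> eventually_fixed F y"
      using extension_by_truncation[OF \<open>compact (endpoints Y)\<close> 3(3) sub h(2,3) assms(3,4)] by blast
    then show ?thesis
      by blast
  qed
qed

end
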